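(* Consider the scalar plant $x_{t+1}=ax_t+u_t+w_t$, $0\le t\le T$, the noiseless discrete channel with alphabet $\{1,\dots,N\}$ of constant size $N$, and the cost $$J=\mathbb{E}\Big[x_{T+1}^2+p\sum_{i=1}^{T}x_i^2+q\sum_{i=0}^{T}u_i^2\Big],\qquad p,q>0 .$$ Consider the problem of choosing jointly causal encoding policies $\{\mathcal{E}_t\}_0^T$ and causal control policies $\{\mathcal{K}_t\}_0^T$ to minimize $J$ over all admissible pairs (dynamic encoder-controller design). Let $$\beta_{T+1}=1,\quad \beta_i=p+\frac{a^2q\,\beta_{i+1}}{q+\beta_{i+1}},\quad k_i^*=a\,\frac{\beta_{i+1}}{q+\beta_{i+1}},\quad \lambda_i=\frac{a^2\beta_{i+1}^2}{q+\beta_{i+1}} .$$ Then $J$ is minimized by applying the linear control laws $$u_t^*=-k_t^*\,\widehat{x}_{t|t},\qquad 0\le t\le T,$$ in combination with the encoder $z_t=\epsilon_t^*(\zeta_t)$, which is controls-forgetting from time $0$, given by $$\epsilon_t^*\big(\cdot\,;\{z_i\}_0^{t-1},\{\epsilon_i(\cdot)\}_0^{t-1}\big)=\underset{\epsilon(\cdot)}{\arg\inf}\ \Gamma_t\big(\epsilon(\cdot)\,;\{z_i\}_0^{t-1},\{\epsilon_i(\cdot)\}_0^{t-1}\big),$$ where $\epsilon$ ranges over Borel maps $\mathbb{R}\to\{1,\dots,N\}$ and $$\Gamma_T(\epsilon_T)=\lambda_T\,\mathbb{E}\Big[(\zeta_T-\widehat{\zeta}_{T|T})^2\,\Big|\,\epsilon_T(\cdot),\{z_i\}_0^{T-1},\{\epsilon_i(\cdot)\}_0^{T-1}\Big],$$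 and for $t<T$ $$\Gamma_t(\epsilon_t)=\lambda_t\,\mathbb{E}\Big[(\zeta_t-\widehat{\zeta}_{t|t})^2\,\Big|\,\epsilon_t(\cdot),\{z_i\}_0^{t-1},\{\epsilon_i(\cdot)\}_0^{t-1}\Big]+\mathbb{E}\Big[\Gamma_{t+1}^*\big(\{z_i\}_0^{t},\{\epsilon_i(\cdot)\}_0^{t}\big)\,\Big|\,\epsilon_t(\cdot),\{z_i\}_0^{t-1},\{\epsilon_i(\cdot)\}_0^{t-1}\Big],$$ with $\Gamma_t^*=\inf_{\epsilon(\cdot)}\Gamma_t(\epsilon)$. Moreover, this control law is a certainty equivalence law.
   Context: Plant and noise: $a\in\mathbb{R}$ is known, all signals are real valued. The $w_t$ are independent with zero mean and constant variance $\sigma_w^2$; $x_0$ has mean $\overline{x}_0$ and variance $\sigma_0^2$; at each $t$, $w_t$ is independent of all state, control, channel input and channel output data up to and including time $t$. The encoder observes the state perfectly. The statistics of all primitive random variables are known to encoder and controller. Channel and admissible policies: at each time the encoder emits $z_t\in\{1,\dots,N\}$, received without error or delay by the controller. An admissible encoder is a causal measurable map $(t,\{x_i\}_0^t,\{z_i\}_0^{t-1},\{\mathcal{K}_i(\cdot)\}_0^{t-1})\mapsto z_t$; the encoder knows all control policies. An admissible controller is a causal measurable map $(t,\{z_i\}_0^t,\{u_i\}_0^{t-1})\mapsto u_t\in\mathbb{R}$. It is a standing assumption that measurable policies attaining the minima (and infima above) exist. Notation: at time $t$ the encoder is viewed as a map $\xi_t(\cdot)$ of the current state (or of $\zeta_t$)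 whose shape depends on past data. $\mathscr{D}^{\rm con}_{t^-}=\{\{z_i\}_0^t,\{\xi_i(\cdot)\}_0^t,\{u_i\}_0^{t-1}\}$ and $\mathscr{D}^{\rm con}_{t^+}=\{\mathscr{D}^{\rm con}_{t^-},u_t\}$ are the controller's data just before and just after generating $u_t$; $\widehat{x}_{t|t}=\mathbb{E}[x_t\mid\mathscr{D}^{\rm con}_{t^-}]$. The control-free part of the state is $\zeta_0=x_0$, $\zeta_{t+1}=x_{t+1}-\sum_{j=0}^{t}a^{t-j}u_j$, so $\zeta_{t+1}=a\zeta_t+w_t$; it is computable by the encoder. $\widehat{\zeta}_{t|t}=\mathbb{E}[\zeta_t\mid\{z_i\}_0^t,\{\epsilon_i(\cdot)\}_0^t]$, where $z_i=\epsilon_i(\zeta_i)$. Controls-forgetting encoder from time $\tau$: an admissible encoding strategy which for $t\le\tau$ is any admissible policy $\xi_t^\dagger(x_t;\mathscr{D}^{\rm con}_{(t-1)^-})$, and for $t\ge\tau+1$ has the form $\epsilon_t(\zeta_t;\rho^\zeta_{\tau|\tau-1}(\cdot),\{z_i\}_\tau^{t-1},\{\epsilon_i(\cdot)\}_\tau^{t-1})$, where $\rho^\zeta_{\tau|\tau-1}$ is the conditional density of $\zeta_\tau$ given $\mathscr{D}^{\rm con}_{(\tau-1)^-}$, and where for fixed values of $(\rho^\zeta_{\tau|\tau-1},\{z_i\}_\tau^{t-1},\{\epsilon_i\}_\tau^{t-1})$ the map $\epsilon_t(\cdot)$ produces the same output regardless of the controls $\{u_i\}_\tau^t$ and of the control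 policies $\{\mathcal{K}_i(\cdot)\}_{t+1}^T$. Certainty equivalence law: let $L=x_{T+1}^2+p\sum_{i=1}^Tx_i^2+q\sum_{i=0}^Tu_i^2$. For a sample point $\omega$ (fixing all primitive random variables) and given past controls $\{u_i\}_0^{t-1}$, let $u_t^*(\omega)$ be the time-$t$ component of the remaining control sequence minimizing $L$ when all primitive random variables are known exactly. The certainty equivalence law is $u_t=\mathbb{E}[u_t^*(\omega)\mid\{z_i\}_0^t,\{u_i\}_0^{t-1}]$. *)

theory Defs
  imports "HOL-Probability.Probability"
begin

section \<open>Problem data\<close>

text \<open>
  Time runs over \<open>0..hor S\<close>; \<open>noise S t\<close> is only relevant for \<open>t \<le> hor S\<close>.  Histories such as
  \<open>z\<^sub>0,...,z\<^sub>t\<close> are extensional functions on \<open>{..t}\<close>, so that causality is built into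
  the types of arguments passed to the policies.
\<close>

record 'w lqg =
  Pr :: "'w measure"
  gain :: real
  pwt :: real
  qwt :: real
  nsym :: nat
  hor :: nat
  init :: "'w \<Rightarrow> real"
  noise :: "nat \<Rightarrow> 'w \<Rightarrow> real"

abbreviation alphabet :: "'w lqg \<Rightarrow> nat set" where
  "alphabet S \<equiv> {1..nsym S}"

section \<open>Policies and the closed loop\<close>

text \<open>
  \<open>K t z u\<close> is the control at time \<open>t\<close>; \<open>E t x z K\<close> is the channel symbol at time \<open>t\<close>, where the
  encoder also receives the control policies used strictly before \<open>t\<close>.  There is no sigma-algebra
  on policies, so measurability of an encoder is understood in \<open>(x, z)\<close> for every fixed \<open>K\<close>.
\<close>

type_synonym controller = "nat \<Rightarrow> (nat \<Rightarrow> nat) \<Rightarrow> (nat \<Rightarrow> real) \<Rightarrow> real"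
type_synonym encoder = "nat \<Rightarrow> (nat \<Rightarrow> real) \<Rightarrow> (nat \<Rightarrow> nat) \<Rightarrow> controller \<Rightarrow> nat"

definition ctrl_space :: "'w lqg \<Rightarrow> nat \<Rightarrow> ((nat \<Rightarrow> nat) \<times> (nat \<Rightarrow> real)) measure" where
  "ctrl_space S t =
     (\<Pi>\<^sub>M i\<in>{..t}. count_space (alphabet S)) \<Otimes>\<^sub>M (\<Pi>\<^sub>M i\<in>{..<t}. borel)"

definition enc_space :: "'w lqg \<Rightarrow> nat \<Rightarrow> ((nat \<Rightarrow> real) \<times> (nat \<Rightarrow> nat)) measure" where
  "enc_space S t =
     (\<Pi>\<^sub>M i\<in>{..t}. borel) \<Otimes>\<^sub>M (\<Pi>\<^sub>M i\<in>{..<t}. count_space (alphabet S))"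

definition admissible_controller :: "'w lqg \<Rightarrow> controller \<Rightarrow> bool" where
  "admissible_controller S K \<longleftrightarrow>
     (\<forall>t\<le>hor S. (\<lambda>(z, u). K t z u) \<in> ctrl_space S t \<rightarrow>\<^sub>M borel)"

definition admissible_encoder :: "'w lqg \<Rightarrow> encoder \<Rightarrow> bool" where
  "admissible_encoder S E \<longleftrightarrow>
     (\<forall>K. admissible_controller S K \<longrightarrow>
        (\<forall>t\<le>hor S. (\<lambda>(x, z). E t x z (restrict K {..<t}))
           \<in> enc_space S t \<rightarrow>\<^sub>M count_space (alphabet S)))"

lemma restrict_fundef_cong [fundef_cong]:
  "A = B \<Longrightarrow> (\<And>i. i \<in> B \<Longrightarrow> f i = g i) \<Longrightarrow> restrict f A = restrict g B"
  by (auto simp: restrict_def)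

function state :: "'w lqg \<Rightarrow> encoder \<Rightarrow> controller \<Rightarrow> nat \<Rightarrow> 'w \<Rightarrow> real"
  and symb :: "'w lqg \<Rightarrow> encoder \<Rightarrow> controller \<Rightarrow> nat \<Rightarrow> 'w \<Rightarrow> nat"
  and control :: "'w lqg \<Rightarrow> encoder \<Rightarrow> controller \<Rightarrow> nat \<Rightarrow> 'w \<Rightarrow> real" where
  "state S E K 0 \<omega> = init S \<omega>"
| "state S E K (Suc t) \<omega> = gain S * state S E K t \<omega> + control S E K t \<omega> + noise S t \<omega>"
| "symb S E K t \<omega> =
     E t (\<lambda>i\<in>{..t}. state S E K i \<omega>) (\<lambda>i\<in>{..<t}. symb S E K i \<omega>) (restrict K {..<t})"
| "control S E K t \<omega> = K t (\<lambda>i\<in>{..t}. symb S E K i \<omega>) (\<lambda>i\<in>{..<t}. control S E K i \<omega>)"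
  by pat_completeness auto
termination
  by (relation "Wellfounded.measure (\<lambda>r. case r of
        Inl (S, E, K, t, \<omega>) \<Rightarrow> 3 * t
      | Inr (Inl (S, E, K, t, \<omega>)) \<Rightarrow> 3 * t + 1
      | Inr (Inr (S, E, K, t, \<omega>)) \<Rightarrow> 3 * t + 2)") auto

declare symb.simps [simp del] control.simps [simp del]

definition path_cost :: "'w lqg \<Rightarrow> (nat \<Rightarrow> real) \<Rightarrow> (nat \<Rightarrow> real) \<Rightarrow> real" where
  "path_cost S x u =
     (x (Suc (hor S)))\<^sup>2 + pwt S * (\<Sum>i=1..hor S. (x i)\<^sup>2) + qwt S * (\<Sum>i=0..hor S. (u i)\<^sup>2)"

text \<open>
  The cost is an integral in \<open>[0,\<infinity>]\<close>: admissible policies may well have infinite cost, to which the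
  Bochner integral would assign the value 0.
\<close>

definition J :: "'w lqg \<Rightarrow> encoder \<Rightarrow> controller \<Rightarrow> ennreal" where
  "J S E K = (\<integral>\<^sup>+\<omega>. ennreal (path_cost S (\<lambda>i. state S E K i \<omega>) (\<lambda>i. control S E K i \<omega>)) \<partial>Pr S)"

definition optimal_pair :: "'w lqg \<Rightarrow> encoder \<Rightarrow> controller \<Rightarrow> bool" where
  "optimal_pair S E K \<longleftrightarrow>
     admissible_encoder S E \<and> admissible_controller S K \<and>
     (\<forall>E' K'. admissible_encoder S E' \<and> admissible_controller S K' \<longrightarrow> J S E K \<le> J S E' K')"

section \<open>Riccati coefficients\<close>

function beta :: "'w lqg \<Rightarrow> nat \<Rightarrow> real" where
  "beta S i =
     (if hor S < i then 1
      else pwt S + (gain S)\<^sup>2 * qwt S * beta S (Suc i) / (qwt S + beta S (Suc i)))"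
  by pat_completeness auto
termination
  by (relation "Wellfounded.measure (\<lambda>(S, i). Suc (hor S) - i)") auto

declare beta.simps [simp del]

definition kstar :: "'w lqg \<Rightarrow> nat \<Rightarrow> real" where
  "kstar S i = gain S * (beta S (Suc i) / (qwt S + beta S (Suc i)))"

definition lam :: "'w lqg \<Rightarrow> nat \<Rightarrow> real" where
  "lam S i = (gain S)\<^sup>2 * (beta S (Suc i))\<^sup>2 / (qwt S + beta S (Suc i))"

section \<open>The control-free part of the state\<close>

primrec zeta :: "'w lqg \<Rightarrow> nat \<Rightarrow> 'w \<Rightarrow> real" where
  "zeta S 0 \<omega> = init S \<omega>"
| "zeta S (Suc t) \<omega> = gain S * zeta S t \<omega> + noise S t \<omega>"

lemma zeta_eq_state_minus_controls:
  "zeta S t \<omega> = state S E K t \<omega> - (\<Sum>j<t. gain S ^ (t - Suc j) * control S E K j \<omega>)"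
proof (induction t)
  case (Suc t)
  have "(\<Sum>j<t. gain S ^ (t - j) * control S E K j \<omega>)
      = gain S * (\<Sum>j<t. gain S ^ (t - Suc j) * control S E K j \<omega>)"
    unfolding sum_distrib_left
    by (rule sum.cong) (auto simp: Suc_diff_Suc mult.assoc simp flip: power_Suc)
  moreover have "gain S * state S E K t \<omega>
      = gain S * zeta S t \<omega> + gain S * (\<Sum>j<t. gain S ^ (t - Suc j) * control S E K j \<omega>)"
    by (simp add: Suc flip: distrib_left)
  ultimately show ?case
    by simp
qed simp

text \<open>
  The controls are determined by the control policies and the received symbols, which is how the
  encoder computes \<open>\<zeta>\<^sub>t\<close> from \<open>x\<^sub>t\<close>.
\<close>

function ctrl_seq :: "controller \<Rightarrow> (nat \<Rightarrow> nat) \<Rightarrow> nat \<Rightarrow> real" where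
  "ctrl_seq K z t = K t (restrict z {..t}) (\<lambda>i\<in>{..<t}. ctrl_seq K z i)"
  by pat_completeness auto
termination
  by (relation "Wellfounded.measure (\<lambda>(K, z, t). t)") auto

declare ctrl_seq.simps [simp del]

lemma control_eq_ctrl_seq:
  "control S E K t \<omega> = ctrl_seq K (\<lambda>i. symb S E K i \<omega>) t"
proof (induction t rule: less_induct)
  case (less t)
  then have "(\<lambda>i\<in>{..<t}. control S E K i \<omega>) = (\<lambda>i\<in>{..<t}. ctrl_seq K (\<lambda>i. symb S E K i \<omega>) i)"
    by (auto simp: restrict_def)
  then show ?case
    by (simp add: control.simps[of S E K t] ctrl_seq.simps[of K _ t])
qed

definition drift :: "'w lqg \<Rightarrow> controller \<Rightarrow> (nat \<Rightarrow> nat) \<Rightarrow> nat \<Rightarrow> real" where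
  "drift S K z t = (\<Sum>j<t. gain S ^ (t - Suc j) * ctrl_seq K z j)"

section \<open>The encoder design functional\<close>

text \<open>
  Conditioning on the discrete data \<open>z\<^sub>i = \<epsilon>\<^sub>i(\<zeta>\<^sub>i)\<close>, \<open>i < t\<close>, is conditioning on an event.  For an
  event of probability 0, \<^const>\<open>uniform_measure\<close> is the null measure and the conditional
  expectation is 0, so histories that cannot occur put no constraint on the encoder.
\<close>

definition cond_expect :: "'w lqg \<Rightarrow> 'w set \<Rightarrow> ('w \<Rightarrow> real) \<Rightarrow> real" where
  "cond_expect S A f = integral\<^sup>L (uniform_measure (Pr S) A) f"

definition hist_event :: "'w lqg \<Rightarrow> nat \<Rightarrow> (nat \<Rightarrow> nat) \<Rightarrow> (nat \<Rightarrow> real \<Rightarrow> nat) \<Rightarrow> 'w set" where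
  "hist_event S t z e = {\<omega> \<in> space (Pr S). \<forall>i<t. e i (zeta S i \<omega>) = z i}"

definition zeta_hat :: "'w lqg \<Rightarrow> nat \<Rightarrow> (nat \<Rightarrow> nat) \<Rightarrow> (nat \<Rightarrow> real \<Rightarrow> nat) \<Rightarrow> real" where
  "zeta_hat S t z e = cond_expect S (hist_event S (Suc t) z e) (zeta S t)"

definition quantizers :: "'w lqg \<Rightarrow> (real \<Rightarrow> nat) set" where
  "quantizers S = borel \<rightarrow>\<^sub>M count_space (alphabet S)"

function Gam :: "'w lqg \<Rightarrow> nat \<Rightarrow> (real \<Rightarrow> nat) \<Rightarrow> (nat \<Rightarrow> nat) \<Rightarrow> (nat \<Rightarrow> real \<Rightarrow> nat) \<Rightarrow> real" where
  "Gam S t \<epsilon> z e =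
     lam S t * cond_expect S (hist_event S t z e)
       (\<lambda>\<omega>. (zeta S t \<omega> - zeta_hat S t (z(t := \<epsilon> (zeta S t \<omega>))) (e(t := \<epsilon>)))\<^sup>2)
     + (if t < hor S then
          cond_expect S (hist_event S t z e)
            (\<lambda>\<omega>. INF \<epsilon>'\<in>quantizers S. Gam S (Suc t) \<epsilon>' (z(t := \<epsilon> (zeta S t \<omega>))) (e(t := \<epsilon>)))
        else 0)"
  by pat_completeness auto
termination
  by (relation "Wellfounded.measure (\<lambda>(S, t, _). hor S - t)") auto

declare Gam.simps [simp del]

definition Gam_star :: "'w lqg \<Rightarrow> nat \<Rightarrow> (nat \<Rightarrow> nat) \<Rightarrow> (nat \<Rightarrow> real \<Rightarrow> nat) \<Rightarrow> real" where
  "Gam_star S t z e = (INF \<epsilon>\<in>quantizers S. Gam S t \<epsilon> z e)"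

text \<open>
  \<open>eps t z e\<close> is the quantizer \<open>\<epsilon>\<^sub>t(\<cdot>; z, e)\<close> selected at time \<open>t\<close> after the symbols \<open>z\<close> and the
  quantizers \<open>e\<close> have been used at times \<open>0..t-1\<close>.
\<close>

type_synonym quantizer_rule = "nat \<Rightarrow> (nat \<Rightarrow> nat) \<Rightarrow> (nat \<Rightarrow> real \<Rightarrow> nat) \<Rightarrow> real \<Rightarrow> nat"

definition arg_inf_rule :: "'w lqg \<Rightarrow> quantizer_rule \<Rightarrow> bool" where
  "arg_inf_rule S eps \<longleftrightarrow>
     (\<forall>t\<le>hor S. \<forall>z \<in> {..<t} \<rightarrow>\<^sub>E alphabet S. \<forall>e \<in> {..<t} \<rightarrow>\<^sub>E quantizers S.
        eps t z e \<in> quantizers S \<and> Gam S t (eps t z e) z e = Gam_star S t z e)"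

function realized_quantizer :: "quantizer_rule \<Rightarrow> (nat \<Rightarrow> nat) \<Rightarrow> nat \<Rightarrow> real \<Rightarrow> nat" where
  "realized_quantizer eps z t =
     eps t (restrict z {..<t}) (\<lambda>i\<in>{..<t}. realized_quantizer eps z i)"
  by pat_completeness auto
termination
  by (relation "Wellfounded.measure (\<lambda>(eps, z, t). t)") auto

declare realized_quantizer.simps [simp del]

definition zeta_encoder :: "'w lqg \<Rightarrow> quantizer_rule \<Rightarrow> encoder" where
  "zeta_encoder S eps t x z K = realized_quantizer eps z t (x t - drift S K z t)"

section \<open>Controls-forgetting encoders\<close>

text \<open>
  For an encoder whose output depends on the states only through the current one,
  \<open>zeta_map S E K z t\<close> is that encoder at time \<open>t\<close> as a map of \<open>\<zeta>\<^sub>t\<close>; the states before time \<open>t\<close>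
  passed to \<open>E\<close> are then immaterial.
\<close>

definition zeta_map :: "'w lqg \<Rightarrow> encoder \<Rightarrow> controller \<Rightarrow> (nat \<Rightarrow> nat) \<Rightarrow> nat \<Rightarrow> real \<Rightarrow> nat" where
  "zeta_map S E K z t =
     (\<lambda>s. E t (\<lambda>i\<in>{..t}. s + drift S K z t) (restrict z {..<t}) (restrict K {..<t}))"

text \<open>
  The conditional law of \<open>\<zeta>\<^sub>\<tau>\<close> given the controller's data at time \<open>\<tau> - 1\<close>; past controls and
  encoder maps are functions of the received symbols.
\<close>

definition zeta_law :: "'w lqg \<Rightarrow> encoder \<Rightarrow> controller \<Rightarrow> nat \<Rightarrow> (nat \<Rightarrow> nat) \<Rightarrow> real measure" where
  "zeta_law S E K \<tau> z =
     distr (uniform_measure (Pr S) {\<omega> \<in> space (Pr S). \<forall>i<\<tau>. symb S E K i \<omega> = z i})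
       borel (zeta S \<tau>)"

text \<open>
  Independence of controls and control policies is expressed by choosing \<open>eps\<close> before \<open>K\<close>.
\<close>

definition controls_forgetting :: "'w lqg \<Rightarrow> nat \<Rightarrow> encoder \<Rightarrow> bool" where
  "controls_forgetting S \<tau> E \<longleftrightarrow>
     admissible_encoder S E \<and>
     (\<forall>K. admissible_controller S K \<longrightarrow>
        (\<forall>t\<le>hor S. \<forall>z \<in> {..<t} \<rightarrow>\<^sub>E alphabet S.
           \<forall>x \<in> {..t} \<rightarrow>\<^sub>E UNIV. \<forall>x' \<in> {..t} \<rightarrow>\<^sub>E UNIV.
             x t = x' t \<longrightarrow> E t x z (restrict K {..<t}) = E t x' z (restrict K {..<t}))) \<and>
     (\<exists>eps :: nat \<Rightarrow> real measure \<Rightarrow> (nat \<Rightarrow> nat) \<Rightarrow> (nat \<Rightarrow> real \<Rightarrow> nat) \<Rightarrow> real \<Rightarrow> nat.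
        \<forall>K. admissible_controller S K \<longrightarrow>
          (\<forall>t\<in>{\<tau><..hor S}. \<forall>z \<in> {..<t} \<rightarrow>\<^sub>E alphabet S.
             zeta_map S E K z t =
               eps t (zeta_law S E K \<tau> z) (restrict z {\<tau>..<t})
                 (\<lambda>i\<in>{\<tau>..<t}. zeta_map S E K z i)))"

section \<open>Linear and certainty equivalence control laws\<close>

text \<open>
  The sigma-algebra of \<open>z\<^sub>0,...,z\<^sub>t, u\<^sub>0,...,u\<^sub>t\<^sub>-\<^sub>1\<close>.  With encoders whose maps at each time are
  determined by the earlier symbols and controls, it also carries the encoder maps.
\<close>

definition ctrl_data :: "'w lqg \<Rightarrow> encoder \<Rightarrow> controller \<Rightarrow> nat \<Rightarrow> 'w measure" where
  "ctrl_data S E K t =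
     vimage_algebra (space (Pr S))
       (\<lambda>\<omega>. (\<lambda>i\<in>{..t}. symb S E K i \<omega>, \<lambda>i\<in>{..<t}. control S E K i \<omega>)) (ctrl_space S t)"

definition x_hat :: "'w lqg \<Rightarrow> encoder \<Rightarrow> controller \<Rightarrow> nat \<Rightarrow> 'w \<Rightarrow> real" where
  "x_hat S E K t = real_cond_exp (Pr S) (ctrl_data S E K t) (state S E K t)"

text \<open>
  The estimate depends on the closed loop, hence on the controller itself, so the linear law is a
  property of a controller rather than an explicit formula for it.
\<close>

definition linear_law :: "'w lqg \<Rightarrow> encoder \<Rightarrow> controller \<Rightarrow> bool" where
  "linear_law S E K \<longleftrightarrow>
     (\<forall>t\<le>hor S. AE \<omega> in Pr S. control S E K t \<omega> = - kstar S t * x_hat S E K t \<omega>)"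

primrec open_loop_state :: "'w lqg \<Rightarrow> (nat \<Rightarrow> real) \<Rightarrow> 'w \<Rightarrow> nat \<Rightarrow> real" where
  "open_loop_state S u \<omega> 0 = init S \<omega>"
| "open_loop_state S u \<omega> (Suc t) = gain S * open_loop_state S u \<omega> t + u t + noise S t \<omega>"

definition known_noise_control :: "'w lqg \<Rightarrow> nat \<Rightarrow> (nat \<Rightarrow> real) \<Rightarrow> 'w \<Rightarrow> real" where
  "known_noise_control S t u \<omega> =
     arg_min
       (\<lambda>v. let u' = (\<lambda>i. if i < t then u i else v i)
            in path_cost S (open_loop_state S u' \<omega>) u')
       (\<lambda>v. v \<in> {t..hor S} \<rightarrow>\<^sub>E UNIV) t"

definition certainty_equivalence_law :: "'w lqg \<Rightarrow> encoder \<Rightarrow> controller \<Rightarrow> bool" where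
  "certainty_equivalence_law S E K \<longleftrightarrow>
     (\<forall>t\<le>hor S.
        let ustar = (\<lambda>\<omega>. known_noise_control S t (\<lambda>i\<in>{..<t}. control S E K i \<omega>) \<omega>)
        in integrable (Pr S) ustar \<and>
           (AE \<omega> in Pr S. control S E K t \<omega> = real_cond_exp (Pr S) (ctrl_data S E K t) ustar \<omega>))"

end

theory Submission
  imports Defs
begin

text \<open>
  Write \<open>\<beta>\<close>, \<open>k\<close>, \<open>\<lambda>\<close> for the Riccati coefficients, \<open>D\<^sub>t = q + \<beta>\<^sub>t\<^sub>+\<^sub>1\<close>, and call
  \<open>u\<^sub>t + k\<^sub>t x\<^sub>t\<close> the gap at time \<open>t\<close>.  The theorem is a separation principle: the cost splits into a
  part that no policy influences and weighted squared gaps; the best control reduces a gap to an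
  estimation error, and estimating \<open>x\<^sub>t\<close> from the symbols is the same as estimating the control-free
  part \<open>\<zeta>\<^sub>t\<close>.

  Completing squares along a single trajectory, with the noise sequence regarded as
  known, leaves a cost \<open>\<Sum> D\<^sub>t (u\<^sub>t + k\<^sub>t x\<^sub>t + r\<^sub>t)\<^sup>2\<close> plus terms free of the controls, where \<open>r\<^sub>t\<close> is a
  linear combination of \<open>w\<^sub>t, ..., w\<^sub>T\<close> (\<open>path_cost_complete_squares\<close>).  This single identity
  serves twice.  It shows that the control minimizing the cost with full knowledge of the noise is
  \<open>- k\<^sub>t x\<^sub>t - r\<^sub>t\<close>, so that the certainty equivalence law is \<open>- k\<^sub>t\<close> times the conditional mean of
  \<open>x\<^sub>t\<close>, the noise still to come being independent of the data.  And since \<open>r\<^sub>t\<close> is uncorrelated with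
  everything up to time \<open>t\<close>, taking expectations gives
  \<open>J = C + \<Sum> D\<^sub>t E (u\<^sub>t + k\<^sub>t x\<^sub>t)\<^sup>2\<close> with \<open>C\<close> independent of the policies (\<open>J_decomposition\<close>).
  All these expectations are finite: the primitive variables are square integrable, and a control
  takes finitely many values.

  For an arbitrary admissible pair, \<open>u\<^sub>t\<close> and \<open>x\<^sub>t - \<zeta>\<^sub>t\<close> are functions of
  the symbols received, so \<open>D\<^sub>t (u\<^sub>t + k\<^sub>t x\<^sub>t)\<^sup>2\<close> dominates \<open>\<lambda>\<^sub>t (\<zeta>\<^sub>t - d\<^sub>t)\<^sup>2\<close> for some decoder \<open>d\<^sub>t\<close> reading
  those symbols.  Hold the decoder fixed.  Then the encoder faces a Markov decision problem with
  state \<open>\<zeta>\<^sub>t\<close> and the symbols sent so far, whose cost-to-go \<open>decoder_value\<close> bounds the cost of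
  every causal encoder from below (\<open>decoder_value_le_error\<close>) and is attained by quantizers of
  \<open>\<zeta>\<^sub>t\<close> selected by the past symbols.  This is why remembering past states does not help the
  encoder.  Replacing the fixed decoder by the conditional mean can only lower the error of such a quantizer, and induction
  backwards in time bounds the cost-to-go from below by \<open>\<Gamma>\<^sup>*\<close> (\<open>Gam_star_le_decoder_value\<close>).

  Conversely, for quantizers that attain the infima, unfolding \<open>\<Gamma>\<^sup>*\<close> gives exactly the sum of
  \<open>\<lambda>\<^sub>t E (\<zeta>\<^sub>t - \<zeta>\<^sub>t\<^sub>|\<^sub>t)\<^sup>2\<close>, \<open>\<zeta>\<^sub>t\<^sub>|\<^sub>t\<close> being the conditional mean (\<open>Gam_star_eq_realized_error\<close>), and with
  the linear law the gap equals \<open>k\<^sub>t (\<zeta>\<^sub>t - \<zeta>\<^sub>t\<^sub>|\<^sub>t)\<close>.  The symbols produced by the quantizers of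
  \<open>\<zeta>\<^sub>t\<close> do not depend on the control policy, so every controller obeying the linear law reaches the
  lower bound.
\<close>

section \<open>Completing the squares with the noise known in advance\<close>

lemma beta_terminal: "hor S < i \<Longrightarrow> beta S i = 1"
  by (simp add: beta.simps)

lemma beta_step:
  "i \<le> hor S \<Longrightarrow>
    beta S i = pwt S + (gain S)\<^sup>2 * qwt S * beta S (Suc i) / (qwt S + beta S (Suc i))"
  by (subst beta.simps) simp

lemma beta_pos:
  assumes "0 < pwt S" "0 < qwt S"
  shows "0 < beta S i"
  using assms
proof (induction S i rule: beta.induct)
  case (1 S i)
  show ?case
  proof (cases "hor S < i")
    case False
    then have "0 < beta S (Suc i)"
      using 1 by simp
    then show ?thesis
      using 1 False by (simp add: beta_step add_pos_nonneg)
  qed (simp add: beta_terminal)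
qed

text \<open>
  The weight of the squared estimation error is the weight of the squared gap times the squared
  feedback gain, because with the linear law the gap is the gain times the estimation error.
\<close>

lemma lam_eq:
  assumes "0 < pwt S" "0 < qwt S"
  shows "lam S t = (qwt S + beta S (Suc t)) * (kstar S t)\<^sup>2"
proof -
  have "0 < qwt S + beta S (Suc t)"
    using beta_pos[OF assms, of "Suc t"] assms by simp
  then show ?thesis
    by (simp add: lam_def kstar_def power_mult_distrib power_divide power2_eq_square[of "_ + _"])
qed

text \<open>
  The offset \<open>r\<^sub>t\<close> that knowledge of the noise adds to the feedback law: the noise from time \<open>t\<close> on,
  discounted by the closed-loop gains.  It vanishes after the horizon.
\<close>

function preview :: "'w lqg \<Rightarrow> nat \<Rightarrow> 'w \<Rightarrow> real" where
  "preview S i \<omega> =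
     (if hor S < i then 0
      else (beta S (Suc i) * noise S i \<omega> + gain S * qwt S * preview S (Suc i) \<omega>)
             / (qwt S + beta S (Suc i)))"
  by pat_completeness auto
termination
  by (relation "Wellfounded.measure (\<lambda>(S, i, \<omega>). Suc (hor S) - i)") auto

declare preview.simps [simp del]

lemma preview_terminal: "hor S < i \<Longrightarrow> preview S i \<omega> = 0"
  by (simp add: preview.simps)

lemma preview_step:
  "i \<le> hor S \<Longrightarrow>
    preview S i \<omega> = (beta S (Suc i) * noise S i \<omega> + gain S * qwt S * preview S (Suc i) \<omega>)
                      / (qwt S + beta S (Suc i))"
  by (subst preview.simps) simp

text \<open>
  The part of the cost incurred at one step that involves the noise only.
\<close>

definition preview_cost :: "'w lqg \<Rightarrow> nat \<Rightarrow> 'w \<Rightarrow> real" where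
  "preview_cost S i \<omega> =
     beta S (Suc i) * (noise S i \<omega>)\<^sup>2
     + 2 * gain S * qwt S * (preview S (Suc i) \<omega> * noise S i \<omega>)
     - (qwt S + beta S (Suc i)) * (preview S i \<omega>)\<^sup>2"

text \<open>
  The optimal cost from time \<open>i\<close> on when the noise is known, as a function of the state, up to an additive constant.  The term
  linear in the state comes from the noise being known.
\<close>

definition preview_value :: "'w lqg \<Rightarrow> nat \<Rightarrow> 'w \<Rightarrow> real \<Rightarrow> real" where
  "preview_value S i \<omega> x = beta S i * x\<^sup>2 + 2 * gain S * qwt S * (preview S i \<omega> * x)"

text \<open>
  One step of the Riccati recursion with a linear term.  After multiplication by \<open>q + \<beta>\<^sub>t\<^sub>+\<^sub>1\<close> it is a
  polynomial identity, given the equations that define \<open>k\<^sub>t\<close>, \<open>r\<^sub>t\<close> and \<open>\<beta>\<^sub>t\<close>.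
\<close>

lemma complete_square_step:
  assumes w: "0 < pwt S" "0 < qwt S" and i: "i \<le> hor S"
    and x': "x' = gain S * x + u + noise S i \<omega>"
  shows "pwt S * x\<^sup>2 + qwt S * u\<^sup>2 + preview_value S (Suc i) \<omega> x' =
    preview_value S i \<omega> x + preview_cost S i \<omega>
    + (qwt S + beta S (Suc i)) * (u + kstar S i * x + preview S i \<omega>)\<^sup>2"
proof -
  define a p q b w r' where defs: "a = gain S" "p = pwt S" "q = qwt S" "b = beta S (Suc i)"
    "w = noise S i \<omega>" "r' = preview S (Suc i) \<omega>"
  have "0 < b"
    using beta_pos[OF assms(1,2)] by (simp add: defs)
  then have D: "q + b \<noteq> 0"
    using w by (simp add: defs)
  define k r \<beta> where k_def: "k = a * (b / (q + b))"
    and r_def: "r = (b * w + a * q * r') / (q + b)" and \<beta>_def: "\<beta> = p + a\<^sup>2 * q * b / (q + b)"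
  have eqs: "(q + b) * k = a * b" "(q + b) * r = b * w + a * q * r'"
    using D by (simp_all add: k_def r_def)
  have "(q + b) * \<beta> = (q + b) * p + a\<^sup>2 * q * b"
    using D by (simp add: \<beta>_def distrib_left)
  have "(q + b) * (p * x\<^sup>2 + q * u\<^sup>2 + (b * (a * x + u + w)\<^sup>2 + 2 * a * q * (r' * (a * x + u + w))))
     = (q + b) * (\<beta> * x\<^sup>2 + 2 * a * q * (r * x) + (b * w\<^sup>2 + 2 * a * q * (r' * w) - (q + b) * r\<^sup>2)
     + (q + b) * (u + k * x + r)\<^sup>2)" (is "_ * ?l = _ * ?r")
    using eqs \<open>(q + b) * \<beta> = _\<close> by algebra
  then have "?l = ?r"
    using D by simp
  moreover have "kstar S i = k" "preview S i \<omega> = r" "beta S i = \<beta>"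
    by (simp_all add: kstar_def preview_step[OF i] beta_step[OF i] defs k_def r_def \<beta>_def)
  ultimately show ?thesis
    by (simp add: preview_value_def preview_cost_def x' flip: defs)
qed

text \<open>
  The one-step identity telescopes.  With \<open>t = 0\<close> this decomposes the whole cost, and with \<open>t > 0\<close>
  the cost that remains once the controls before \<open>t\<close> are given.  The summand at time 0 is removed since the initial state carries no cost.
\<close>

lemma path_cost_complete_squares:
  assumes w: "0 < pwt S" "0 < qwt S" and t: "t \<le> Suc (hor S)"
    and dyn: "\<And>i. t \<le> i \<Longrightarrow> i \<le> hor S \<Longrightarrow> x (Suc i) = gain S * x i + u i + noise S i \<omega>"
  shows "path_cost S x u =
    (\<Sum>i<t. pwt S * (x i)\<^sup>2 + qwt S * (u i)\<^sup>2) - pwt S * (x 0)\<^sup>2 + preview_value S t \<omega> (x t)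
    + (\<Sum>i=t..hor S. preview_cost S i \<omega>)
    + (\<Sum>i=t..hor S. (qwt S + beta S (Suc i)) * (u i + kstar S i * x i + preview S i \<omega>)\<^sup>2)"
  using t dyn
proof (induction t rule: inc_induct)
  case base
  have "(\<Sum>i<Suc (hor S). (x i)\<^sup>2) = (x 0)\<^sup>2 + (\<Sum>i=1..hor S. (x i)\<^sup>2)"
    by (simp add: sum.lessThan_Suc_shift sum.atLeast1_atMost_eq del: sum.lessThan_Suc)
  moreover have "{0..hor S} = {..<Suc (hor S)}"
    by auto
  ultimately show ?case
    by (simp add: path_cost_def preview_value_def beta_terminal preview_terminal sum.distrib
      distrib_left del: sum.lessThan_Suc flip: sum_distrib_left)
next
  case (step t)
  have split: "(\<Sum>i=t..hor S. f i) = f t + (\<Sum>i=Suc t..hor S. f i)" for f :: "nat \<Rightarrow> real"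
    using step.hyps by (simp add: sum.atLeast_Suc_atMost)
  have "path_cost S x u = 
    (\<Sum>i<Suc t. pwt S * (x i)\<^sup>2 + qwt S * (u i)\<^sup>2) - pwt S * (x 0)\<^sup>2
    + preview_value S (Suc t) \<omega> (x (Suc t))
    + (\<Sum>i=Suc t..hor S. preview_cost S i \<omega>)
    + (\<Sum>i=Suc t..hor S. (qwt S + beta S (Suc i)) * (u i + kstar S i * x i + preview S i \<omega>)\<^sup>2)"
    by (rule step.IH) (use step in auto)
  then show ?case
    using complete_square_step[OF w, of t "x (Suc t)" "x t" "u t" \<omega>] step
    by (simp add: split)
qed

section \<open>The certainty equivalence control\<close>

lemma open_loop_state_cong:
  "(\<And>i. i < t \<Longrightarrow> u i = u' i) \<Longrightarrow> open_loop_state S u \<omega> t = open_loop_state S u' \<omega> t"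
  by (induction t) auto

text \<open>
  The squares can be made to vanish simultaneously: each control only affects later states, so the
  controls can be chosen one after the other.
\<close>

lemma ex_zero_gap_controls:
  assumes "t \<le> n"
  shows "\<exists>v \<in> {t..<n} \<rightarrow>\<^sub>E UNIV. \<forall>i\<in>{t..<n}.
    v i + kstar S i * open_loop_state S (\<lambda>i. if i < t then u i else v i) \<omega> i + preview S i \<omega> = 0"
  using assms
proof (induction n rule: dec_induct)
  case base
  show ?case by auto
next
  case (step n)
  then obtain v where v: "v \<in> {t..<n} \<rightarrow>\<^sub>E UNIV" "\<And>i. i \<in> {t..<n} \<Longrightarrow>
      v i + kstar S i * open_loop_state S (\<lambda>i. if i < t then u i else v i) \<omega> i + preview S i \<omega> = 0"
    by blast
  define v' where "v' = v(n := - (kstar S n *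
      open_loop_state S (\<lambda>i. if i < t then u i else v i) \<omega> n + preview S n \<omega>))"
  have same: "open_loop_state S (\<lambda>i. if i < t then u i else v' i) \<omega> i
      = open_loop_state S (\<lambda>i. if i < t then u i else v i) \<omega> i" if "i \<le> n" for i
    by (rule open_loop_state_cong) (use that in \<open>auto simp: v'_def\<close>)
  have "v' \<in> {t..<Suc n} \<rightarrow>\<^sub>E UNIV"
    using v(1) step.hyps by (auto simp: v'_def PiE_def extensional_def)
  moreover have "\<forall>i\<in>{t..<Suc n}. v' i
      + kstar S i * open_loop_state S (\<lambda>i. if i < t then u i else v' i) \<omega> i + preview S i \<omega> = 0"
  proof
    fix i assume "i \<in> {t..<Suc n}"
    then show "v' i + kstar S i * open_loop_state S (\<lambda>i. if i < t then u i else v' i) \<omega> i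
        + preview S i \<omega> = 0"
      using v(2)[of i] same[of i] by (cases "i = n") (auto simp: v'_def)
  qed
  ultimately show ?case by blast
qed

text \<open>
  A control sequence is optimal exactly if it annihilates all squares.  This determines its component
  at time \<open>t\<close>, whichever minimizer is selected.
\<close>

lemma known_noise_control_eq:
  assumes w: "0 < pwt S" "0 < qwt S" and t: "t \<le> hor S"
  shows "known_noise_control S t u \<omega> =
    - (kstar S t * open_loop_state S u \<omega> t + preview S t \<omega>)"
proof -
  define ext where "ext v = (\<lambda>i. if i < t then u i else v i)" for v :: "nat \<Rightarrow> real"
  define f where "f v = path_cost S (open_loop_state S (ext v) \<omega>) (ext v)" for v
  define gap where "gap v i = ext v i + kstar S i * open_loop_state S (ext v) \<omega> i + preview S i \<omega>"
    for v i
  define c where "c = (\<Sum>i<t. pwt S * (open_loop_state S u \<omega> i)\<^sup>2 + qwt S * (u i)\<^sup>2)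
    - pwt S * (open_loop_state S u \<omega> 0)\<^sup>2 + preview_value S t \<omega> (open_loop_state S u \<omega> t)
    + (\<Sum>i=t..hor S. preview_cost S i \<omega>)"
  define P where "P v \<longleftrightarrow> v \<in> {t..hor S} \<rightarrow>\<^sub>E (UNIV :: real set)" for v
  have past: "open_loop_state S (ext v) \<omega> i = open_loop_state S u \<omega> i" if "i \<le> t" for v i
    by (rule open_loop_state_cong) (use that in \<open>auto simp: ext_def\<close>)
  have f: "f v = c + (\<Sum>i=t..hor S. (qwt S + beta S (Suc i)) * (gap v i)\<^sup>2)" for v
  proof -
    have "(\<Sum>i<t. pwt S * (open_loop_state S (ext v) \<omega> i)\<^sup>2 + qwt S * (ext v i)\<^sup>2)
        = (\<Sum>i<t. pwt S * (open_loop_state S u \<omega> i)\<^sup>2 + qwt S * (u i)\<^sup>2)"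
      by (rule sum.cong) (auto simp: past, simp add: ext_def)
    then show ?thesis
      unfolding f_def c_def gap_def
      by (subst path_cost_complete_squares[OF w, of t _ _ \<omega>]) (use t in \<open>auto simp: past\<close>)
  qed
  have pos: "0 < qwt S + beta S (Suc i)" for i
    using w beta_pos[OF w, of "Suc i"] by simp
  have nonneg: "0 \<le> (qwt S + beta S (Suc i)) * (gap v i)\<^sup>2" for v i
    using pos[of i] by simp
  have "{t..<Suc (hor S)} = {t..hor S}"
    by auto
  with ex_zero_gap_controls[of t "Suc (hor S)" S u \<omega>] t
  obtain v0 where "P v0" and "\<And>i. i \<in> {t..hor S} \<Longrightarrow> gap v0 i = 0"
    unfolding P_def gap_def ext_def by auto
  then have v0: "P v0" "f v0 = c"
    by (auto simp: f)
  \<comment> \<open>Some minimizer exists, so the selected sequence is one; it need not be \<open>v0\<close> a priori.\<close>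
  then have "is_arg_min f P v0"
    by (auto simp: is_arg_min_linorder f sum_nonneg nonneg)
  then have "is_arg_min f P (arg_min f P)"
    unfolding arg_min_def by (rule someI[where P="is_arg_min f P"])
  then have "f (arg_min f P) \<le> c"
    using v0 by (metis is_arg_min_linorder)
  then have "(\<Sum>i=t..hor S. (qwt S + beta S (Suc i)) * (gap (arg_min f P) i)\<^sup>2) = 0"
    by (intro antisym sum_nonneg nonneg) (simp add: f)
  then have "gap (arg_min f P) t = 0"
    using t pos[of t] by (subst (asm) sum_nonneg_eq_0_iff) (auto simp: nonneg dest!: bspec[of _ _ t])
  moreover have "known_noise_control S t u \<omega> = arg_min f P t"
    unfolding known_noise_control_def f_def ext_def P_def Let_def by simp
  ultimately show ?thesis
    by (simp add: gap_def past) (simp add: ext_def)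
qed

section \<open>Controls and quantizers as functions of the received symbols\<close>

lemma ctrl_seq_cong:
  assumes "\<And>i. i \<le> t \<Longrightarrow> z i = z' i" "\<And>i. i \<le> t \<Longrightarrow> K i = K' i"
  shows "ctrl_seq K z t = ctrl_seq K' z' t"
  using assms
proof (induction t rule: less_induct)
  case (less t)
  have "restrict z {..t} = restrict z' {..t}"
    using less.prems by (auto simp: restrict_def)
  moreover have "(\<lambda>i\<in>{..<t}. ctrl_seq K z i) = (\<lambda>i\<in>{..<t}. ctrl_seq K' z' i)"
    using less by (auto simp: restrict_def)
  ultimately show ?case
    using less.prems by (simp add: ctrl_seq.simps[of _ _ t])
qed

lemma drift_cong:
  assumes "\<And>i. i < t \<Longrightarrow> z i = z' i" "\<And>i. i < t \<Longrightarrow> K i = K' i"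
  shows "drift S K z t = drift S K' z' t"
  unfolding drift_def using assms by (intro sum.cong refl arg_cong2[where f="(*)"] ctrl_seq_cong) auto

lemma realized_quantizer_cong:
  assumes "\<And>i. i < t \<Longrightarrow> z i = z' i"
  shows "realized_quantizer eps z t = realized_quantizer eps z' t"
  using assms
proof (induction t rule: less_induct)
  case (less t)
  have "restrict z {..<t} = restrict z' {..<t}"
    using less.prems by (auto simp: restrict_def)
  moreover have "(\<lambda>i\<in>{..<t}. realized_quantizer eps z i) = (\<lambda>i\<in>{..<t}. realized_quantizer eps z' i)"
    using less by (auto simp: restrict_def)
  ultimately show ?case
    by (simp add: realized_quantizer.simps[of _ _ t])
qed

lemma state_eq_zeta_plus_drift:
  "state S E K t \<omega> = zeta S t \<omega> + drift S K (\<lambda>i. symb S E K i \<omega>) t"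
  by (simp add: drift_def zeta_eq_state_minus_controls[of S t \<omega> E K] control_eq_ctrl_seq)

text \<open>
  The encoder subtracts the effect of the controls, so the symbols follow a recursion in which the
  control policy no longer occurs.
\<close>

lemma symb_zeta_encoder:
  "symb S (zeta_encoder S eps) K t \<omega> =
    realized_quantizer eps (\<lambda>i. symb S (zeta_encoder S eps) K i \<omega>) t (zeta S t \<omega>)"
proof -
  let ?z = "\<lambda>i. symb S (zeta_encoder S eps) K i \<omega>"
  have "drift S (restrict K {..<t}) (restrict ?z {..<t}) t = drift S K ?z t"
    "realized_quantizer eps (restrict ?z {..<t}) t = realized_quantizer eps ?z t"
    by (auto intro: drift_cong realized_quantizer_cong)
  then show ?thesis
    by (subst symb.simps) (simp add: zeta_encoder_def state_eq_zeta_plus_drift)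
qed

lemma zeta_map_zeta_encoder:
  "zeta_map S (zeta_encoder S eps) K z t = realized_quantizer eps z t"
proof -
  have "drift S (restrict K {..<t}) (restrict z {..<t}) t = drift S K z t"
    "realized_quantizer eps (restrict z {..<t}) t = realized_quantizer eps z t"
    by (auto intro: drift_cong realized_quantizer_cong)
  then show ?thesis
    by (simp add: zeta_map_def zeta_encoder_def)
qed

lemma open_loop_state_control:
  "open_loop_state S (\<lambda>i. control S E K i \<omega>) \<omega> t = state S E K t \<omega>"
  by (induction t) auto

section \<open>Encoding against a fixed decoder: the cost-to-go\<close>

text \<open>
  The decoder \<open>d\<close> turns the symbols received into an estimate of \<open>\<zeta>\<^sub>t\<close>; the value is the least
  expected error, weighted by \<open>\<lambda>\<close>, from time \<open>t\<close> on when \<open>\<zeta>\<^sub>t = s\<close> and the symbols \<open>z\<close> have been sent.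
  Values in \<open>[0, \<infinity>]\<close> make the recursion meaningful without any integrability argument.
\<close>

function decoder_value ::
  "'w lqg \<Rightarrow> (nat \<Rightarrow> (nat \<Rightarrow> nat) \<Rightarrow> real) \<Rightarrow> nat \<Rightarrow> (nat \<Rightarrow> nat) \<Rightarrow> real \<Rightarrow> ennreal" where
  "decoder_value S d t z s =
     (INF a\<in>alphabet S. ennreal (lam S t * (s - d t (z(t := a)))\<^sup>2)
        + (if t < hor S
           then \<integral>\<^sup>+\<omega>. decoder_value S d (Suc t) (z(t := a)) (gain S * s + noise S t \<omega>) \<partial>Pr S
           else 0))"
  by pat_completeness auto
termination
  by (relation "Wellfounded.measure (\<lambda>(S, d, t, _). hor S - t)") auto

declare decoder_value.simps [simp del]

text \<open>
  The cost-to-go of sending a given symbol now and encoding optimally afterwards.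
\<close>

definition decoder_stage ::
  "'w lqg \<Rightarrow> (nat \<Rightarrow> (nat \<Rightarrow> nat) \<Rightarrow> real) \<Rightarrow> nat \<Rightarrow> (nat \<Rightarrow> nat) \<Rightarrow> nat \<Rightarrow> real \<Rightarrow> ennreal" where
  "decoder_stage S d t z a s = ennreal (lam S t * (s - d t (z(t := a)))\<^sup>2)
     + (if t < hor S
        then \<integral>\<^sup>+\<omega>. decoder_value S d (Suc t) (z(t := a)) (gain S * s + noise S t \<omega>) \<partial>Pr S
        else 0)"

lemma decoder_value_eq: "decoder_value S d t z s = (INF a\<in>alphabet S. decoder_stage S d t z a s)"
  by (subst decoder_value.simps) (simp add: decoder_stage_def)

section \<open>Independence of the noise from the past\<close>

locale lqg_system = prob_space "Pr S" for S :: "'w lqg" +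
  assumes indep: "indep_vars (\<lambda>_. borel) (case_nat (init S) (noise S)) {..Suc (hor S)}"
    and init_sq: "integrable (Pr S) (\<lambda>\<omega>. (init S \<omega>)\<^sup>2)"
    and noise_sq: "\<And>t. t \<le> hor S \<Longrightarrow> integrable (Pr S) (\<lambda>\<omega>. (noise S t \<omega>)\<^sup>2)"
    and noise_mean: "\<And>t. t \<le> hor S \<Longrightarrow> expectation (noise S t) = 0"
    and weights: "0 < pwt S" "0 < qwt S"
    and nonempty_alphabet: "1 \<le> nsym S"
begin

\<comment> \<open>The alphabet \<open>{1..N}\<close> occurs inside function spaces; rewriting its bound would hide them.\<close>
declare One_nat_def [simp del]

abbreviation primitive :: "nat \<Rightarrow> 'w \<Rightarrow> real" where
  "primitive \<equiv> case_nat (init S) (noise S)"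

text \<open>
  The sigma-algebra of \<open>x\<^sub>0, w\<^sub>0, ..., w\<^sub>t\<^sub>-\<^sub>1\<close>.  Everything that is known when the controller acts at time
  \<open>t\<close> is measurable with respect to it, for any policies.
\<close>

definition past :: "nat \<Rightarrow> 'w measure" where
  "past t = vimage_algebra (space (Pr S)) (\<lambda>\<omega>. \<lambda>i\<in>{..t}. primitive i \<omega>) (\<Pi>\<^sub>M i\<in>{..t}. borel)"

lemma space_past [simp]: "space (past t) = space (Pr S)"
  by (simp add: past_def)

lemma primitive_measurable: "i \<le> Suc (hor S) \<Longrightarrow> primitive i \<in> borel_measurable (Pr S)"
  using indep by (auto simp: indep_vars_def)

lemma init_measurable [measurable]: "init S \<in> borel_measurable (Pr S)"
  using primitive_measurable[of 0] by simp

lemma noise_measurable: "t \<le> hor S \<Longrightarrow> noise S t \<in> borel_measurable (Pr S)"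
  using primitive_measurable[of "Suc t"] by simp

lemma sets_past:
  "sets (past t) = {(\<lambda>\<omega>. \<lambda>i\<in>{..t}. primitive i \<omega>) -` A \<inter> space (Pr S) | A. A \<in> sets (\<Pi>\<^sub>M i\<in>{..t}. borel)}"
  unfolding past_def by (rule sets_vimage_algebra2) (auto simp: space_PiM)

lemma primitive_measurable_past: "i \<le> t \<Longrightarrow> primitive i \<in> borel_measurable (past t)"
proof -
  assume i: "i \<le> t"
  have "(\<lambda>\<omega>. \<lambda>i\<in>{..t}. primitive i \<omega>) \<in> past t \<rightarrow>\<^sub>M (\<Pi>\<^sub>M i\<in>{..t}. borel)"
    unfolding past_def by (rule measurable_vimage_algebra1) (auto simp: space_PiM)
  then have "(\<lambda>\<omega>. (\<lambda>i\<in>{..t}. primitive i \<omega>) i) \<in> borel_measurable (past t)"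
    by (rule measurable_compose) (use i in simp)
  then show ?thesis
    using i by simp
qed

lemma init_measurable_past: "init S \<in> borel_measurable (past t)"
  using primitive_measurable_past[of 0 t] by simp

lemma noise_measurable_past: "j < t \<Longrightarrow> noise S j \<in> borel_measurable (past t)"
  using primitive_measurable_past[of "Suc j" t] by simp

lemma measurable_past_mono:
  assumes f: "f \<in> measurable (past s) N" and "s \<le> t"
  shows "f \<in> measurable (past t) N"
proof -
  have "(\<lambda>\<omega>. \<lambda>i\<in>{..s}. primitive i \<omega>) \<in> past t \<rightarrow>\<^sub>M (\<Pi>\<^sub>M i\<in>{..s}. borel)"
    using \<open>s \<le> t\<close> by (intro measurable_restrict primitive_measurable_past) auto
  then have "sets (past s) \<subseteq> sets (past t)"
    unfolding sets_past[of s] by (auto dest: measurable_sets)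
  then show ?thesis
    using f by (auto simp: measurable_def)
qed

lemma subalgebra_past: "t \<le> Suc (hor S) \<Longrightarrow> subalgebra (Pr S) (past t)"
proof -
  assume t: "t \<le> Suc (hor S)"
  have "(\<lambda>\<omega>. \<lambda>i\<in>{..t}. primitive i \<omega>) \<in> Pr S \<rightarrow>\<^sub>M (\<Pi>\<^sub>M i\<in>{..t}. borel)"
    using t by (intro measurable_restrict primitive_measurable) auto
  then show ?thesis
    unfolding subalgebra_def sets_past by (auto dest: measurable_sets)
qed

text \<open>
  Indices up to \<open>T + 1\<close> are allowed, as the final state depends on \<open>w\<^sub>T\<close>.
\<close>

lemma measurable_past_imp:
  "f \<in> measurable (past t) N \<Longrightarrow> t \<le> Suc (hor S) \<Longrightarrow> f \<in> measurable (Pr S) N"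
  by (rule measurable_from_subalg[OF subalgebra_past])

lemma prob_past_noise:
  assumes t: "t \<le> hor S" and A: "A \<in> sets (past t)" and B: "B \<in> sets borel"
  shows "prob (A \<inter> (noise S t -` B \<inter> space (Pr S))) = prob A * prob (noise S t -` B \<inter> space (Pr S))"
proof -
  let ?X = "\<lambda>\<omega>. \<lambda>i\<in>{..t}. primitive i \<omega>" and ?Y = "\<lambda>\<omega>. \<lambda>i\<in>{Suc t}. primitive i \<omega>"
  obtain A' where A': "A' \<in> sets (\<Pi>\<^sub>M i\<in>{..t}. borel)" "A = ?X -` A' \<inter> space (Pr S)"
    using A unfolding sets_past by blast
  define B' where "B' = (\<lambda>f. f (Suc t)) -` B \<inter> space (\<Pi>\<^sub>M i\<in>{Suc t}. borel :: real measure)"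
  have B': "B' \<in> sets (\<Pi>\<^sub>M i\<in>{Suc t}. borel)"
    unfolding B'_def using B by (intro measurable_sets[OF measurable_component_singleton]) auto
  have eq: "?Y -` B' \<inter> space (Pr S) = noise S t -` B \<inter> space (Pr S)"
    by (auto simp: B'_def space_PiM)
  have "indep_var (\<Pi>\<^sub>M i\<in>{..t}. borel) ?X (\<Pi>\<^sub>M i\<in>{Suc t}. borel) ?Y"
    using t by (intro indep_var_restrict[OF indep]) auto
  from indep_varD[OF this A'(1) B']
  have "prob ((\<lambda>\<omega>. (?X \<omega>, ?Y \<omega>)) -` (A' \<times> B') \<inter> space (Pr S)) = prob A * prob (?Y -` B' \<inter> space (Pr S))"
    by (simp add: A'(2))
  moreover have "(\<lambda>\<omega>. (?X \<omega>, ?Y \<omega>)) -` (A' \<times> B') \<inter> space (Pr S) = A \<inter> (?Y -` B' \<inter> space (Pr S))"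
    by (auto simp: A'(2))
  ultimately show ?thesis
    by (simp only: eq)
qed

text \<open>
  Independence in the form needed for Fubini's theorem.  Taking \<open>f\<close> to be the identity, as a map
  into the sigma-algebra of the past, avoids writing functions of the past as functions of the
  primitive variables.
\<close>

lemma joint_law_past_noise:
  assumes t: "t \<le> hor S" and f: "f \<in> past t \<rightarrow>\<^sub>M N"
  shows "distr (Pr S) N f \<Otimes>\<^sub>M distr (Pr S) borel (noise S t)
    = distr (Pr S) (N \<Otimes>\<^sub>M borel) (\<lambda>\<omega>. (f \<omega>, noise S t \<omega>))"
proof -
  note [measurable] = noise_measurable[OF t]
  have fM [measurable]: "f \<in> Pr S \<rightarrow>\<^sub>M N"
    by (rule measurable_past_imp[OF f]) (use t in simp)
  interpret F: prob_space "distr (Pr S) N f"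
    by (rule prob_space_distr) simp
  interpret N: prob_space "distr (Pr S) borel (noise S t)"
    by (rule prob_space_distr) simp
  show ?thesis
  proof (rule pair_measure_eqI)
    fix A B assume AB: "A \<in> sets (distr (Pr S) N f)" "B \<in> sets (distr (Pr S) borel (noise S t))"
    then have [measurable]: "A \<in> sets N" "B \<in> sets borel"
      by auto
    have "f -` A \<inter> space (Pr S) \<in> sets (past t)"
      using measurable_sets[OF f, of A] by simp
    from prob_past_noise[OF t this, of B]
    have "emeasure (Pr S) ((f -` A \<inter> space (Pr S)) \<inter> (noise S t -` B \<inter> space (Pr S)))
      = emeasure (Pr S) (f -` A \<inter> space (Pr S)) * emeasure (Pr S) (noise S t -` B \<inter> space (Pr S))"
      by (simp add: emeasure_eq_measure ennreal_mult)
    moreover have "(f -` A \<inter> space (Pr S)) \<inter> (noise S t -` B \<inter> space (Pr S))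
      = (\<lambda>\<omega>. (f \<omega>, noise S t \<omega>)) -` (A \<times> B) \<inter> space (Pr S)"
      by auto
    ultimately show "emeasure (distr (Pr S) N f) A * emeasure (distr (Pr S) borel (noise S t)) B
      = emeasure (distr (Pr S) (N \<Otimes>\<^sub>M borel) (\<lambda>\<omega>. (f \<omega>, noise S t \<omega>))) (A \<times> B)"
      by (simp add: emeasure_distr)
  qed (auto intro: F.sigma_finite_measure_axioms N.sigma_finite_measure_axioms cong: sets_pair_measure_cong)
qed

text \<open>
  Averaging over the next noise variable with the past frozen does not change an expectation.
\<close>

lemma nn_integral_past_noise:
  assumes t: "t \<le> hor S" and f: "f \<in> borel_measurable (past t \<Otimes>\<^sub>M borel)"
  shows "(\<integral>\<^sup>+\<omega>. f (\<omega>, noise S t \<omega>) \<partial>Pr S) = (\<integral>\<^sup>+\<omega>. (\<integral>\<^sup>+\<omega>'. f (\<omega>, noise S t \<omega>') \<partial>Pr S) \<partial>Pr S)"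
proof -
  note [measurable] = noise_measurable[OF t] f
  have id [measurable]: "(\<lambda>\<omega>. \<omega>) \<in> Pr S \<rightarrow>\<^sub>M past t"
    by (rule measurable_past_imp[where t=t]) (use t in auto)
  interpret N: prob_space "distr (Pr S) borel (noise S t)"
    by (rule prob_space_distr) simp
  have "distr (Pr S) (past t) (\<lambda>\<omega>. \<omega>) \<Otimes>\<^sub>M distr (Pr S) borel (noise S t)
      = distr (Pr S) (past t \<Otimes>\<^sub>M borel) (\<lambda>\<omega>. (\<omega>, noise S t \<omega>))"
    by (rule joint_law_past_noise[OF t]) simp
  then have "(\<integral>\<^sup>+\<omega>. f (\<omega>, noise S t \<omega>) \<partial>Pr S) =
      (\<integral>\<^sup>+p. f p \<partial>(distr (Pr S) (past t) (\<lambda>\<omega>. \<omega>) \<Otimes>\<^sub>M distr (Pr S) borel (noise S t)))"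
    by (simp add: nn_integral_distr)
  also have "\<dots> = (\<integral>\<^sup>+\<omega>. (\<integral>\<^sup>+w. f (\<omega>, w) \<partial>distr (Pr S) borel (noise S t)) \<partial>distr (Pr S) (past t) (\<lambda>\<omega>. \<omega>))"
    by (subst N.nn_integral_fst) auto
  also have "\<dots> = (\<integral>\<^sup>+\<omega>. (\<integral>\<^sup>+w. f (\<omega>, w) \<partial>distr (Pr S) borel (noise S t)) \<partial>Pr S)"
    by (subst nn_integral_distr) auto
  also have "\<dots> = (\<integral>\<^sup>+\<omega>. (\<integral>\<^sup>+\<omega>'. f (\<omega>, noise S t \<omega>') \<partial>Pr S) \<partial>Pr S)"
    by (intro nn_integral_cong, subst nn_integral_distr) auto
  finally show ?thesis .
qed

lemma noise_integrable: "t \<le> hor S \<Longrightarrow> integrable (Pr S) (noise S t)"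
  by (rule square_integrable_imp_integrable[OF noise_measurable noise_sq])

lemma past_noise_uncorrelated:
  assumes t: "t \<le> hor S" and Y: "Y \<in> borel_measurable (past t)" "integrable (Pr S) Y"
  shows "integrable (Pr S) (\<lambda>\<omega>. Y \<omega> * noise S t \<omega>)" "(\<integral>\<omega>. Y \<omega> * noise S t \<omega> \<partial>Pr S) = 0"
proof -
  have ind: "indep_var borel Y borel (noise S t)"
    unfolding indep_var_distribution_eq
    using joint_law_past_noise[OF t Y(1)] noise_measurable[OF t] Y(2) by simp
  show "integrable (Pr S) (\<lambda>\<omega>. Y \<omega> * noise S t \<omega>)"
    by (rule indep_var_integrable[OF ind Y(2) noise_integrable[OF t]])
  show "(\<integral>\<omega>. Y \<omega> * noise S t \<omega> \<partial>Pr S) = 0"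
    using indep_var_lebesgue_integral[OF ind Y(2) noise_integrable[OF t]] noise_mean[OF t] by simp
qed

text \<open>
  The offset \<open>r\<^sub>i\<close> is a linear combination of noise variables from time \<open>i\<close> on, each of which is
  centered and independent of the past.
\<close>

lemma past_preview_uncorrelated:
  assumes Y: "Y \<in> borel_measurable (past t)" "integrable (Pr S) Y" and i: "t \<le> i"
  shows "integrable (Pr S) (\<lambda>\<omega>. Y \<omega> * preview S i \<omega>) \<and> (\<integral>\<omega>. Y \<omega> * preview S i \<omega> \<partial>Pr S) = 0"
proof (cases "i \<le> hor S")
  case True
  then have "i \<le> Suc (hor S)"
    by simp
  then show ?thesis
    using i
  proof (induction i rule: inc_induct)
    case base
    show ?case by (simp add: preview_terminal)
  next
    case (step i)
    then have i: "i \<le> hor S" and IH: "integrable (Pr S) (\<lambda>\<omega>. Y \<omega> * preview S (Suc i) \<omega>)"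
        "(\<integral>\<omega>. Y \<omega> * preview S (Suc i) \<omega> \<partial>Pr S) = 0"
      by auto
    have Yi: "Y \<in> borel_measurable (past i)"
      by (rule measurable_past_mono[OF Y(1)]) (use step in simp)
    note unc = past_noise_uncorrelated[OF i Yi Y(2)]
    have "Y \<omega> * preview S i \<omega> =
        beta S (Suc i) / (qwt S + beta S (Suc i)) * (Y \<omega> * noise S i \<omega>)
        + gain S * qwt S / (qwt S + beta S (Suc i)) * (Y \<omega> * preview S (Suc i) \<omega>)" for \<omega>
      by (simp add: preview_step[OF i] add_divide_distrib distrib_left mult_ac)
    then show ?case
      using unc IH by simp
  qed
qed (simp add: preview_terminal)

lemma preview_measurable: "preview S i \<in> borel_measurable (Pr S)"
proof (cases "i \<le> hor S")
  case True
  then have "i \<le> Suc (hor S)"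
    by simp
  then show ?thesis
  proof (induction i rule: inc_induct)
    case base
    show ?case by (simp add: preview_terminal cong: measurable_cong)
  next
    case (step i)
    then have [measurable]: "noise S i \<in> borel_measurable (Pr S)"
        "preview S (Suc i) \<in> borel_measurable (Pr S)"
      by (auto intro: noise_measurable)
    show ?case
      by (subst measurable_cong[OF preview_step]) (use step in auto)
  qed
qed (simp add: preview_terminal cong: measurable_cong)

text \<open>
  The current noise belongs to the past of the next step.
\<close>

lemma preview_noise_integrable:
  assumes i: "i \<le> hor S"
  shows "integrable (Pr S) (\<lambda>\<omega>. preview S (Suc i) \<omega> * noise S i \<omega>)"
  using past_preview_uncorrelated[OF noise_measurable_past noise_integrable[OF i], of "Suc i" "Suc i"]
  by (simp add: mult.commute)

lemma preview_sq_integrable: "integrable (Pr S) (\<lambda>\<omega>. (preview S i \<omega>)\<^sup>2)"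
proof (cases "i \<le> hor S")
  case True
  then have "i \<le> Suc (hor S)"
    by simp
  then show ?thesis
  proof (induction i rule: inc_induct)
    case base
    show ?case by (simp add: preview_terminal)
  next
    case (step i)
    then have i: "i \<le> hor S"
      by simp
    have "(beta S (Suc i) * noise S i \<omega> + gain S * qwt S * preview S (Suc i) \<omega>)\<^sup>2 =
        (beta S (Suc i))\<^sup>2 * (noise S i \<omega>)\<^sup>2
        + 2 * beta S (Suc i) * gain S * qwt S * (preview S (Suc i) \<omega> * noise S i \<omega>)
        + (gain S * qwt S)\<^sup>2 * (preview S (Suc i) \<omega>)\<^sup>2" for \<omega>
      by algebra
    then show ?case
      using noise_sq[OF i] preview_noise_integrable[OF i] step.IH
      by (simp add: preview_step[OF i] power_divide)
  qed
qed (simp add: preview_terminal)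

lemma preview_integrable: "integrable (Pr S) (preview S i)"
  by (rule square_integrable_imp_integrable[OF preview_measurable preview_sq_integrable])

lemma preview_cost_integrable: "i \<le> hor S \<Longrightarrow> integrable (Pr S) (preview_cost S i)"
  unfolding preview_cost_def[abs_def]
  by (intro Bochner_Integration.integrable_add Bochner_Integration.integrable_diff
    integrable_mult_right noise_sq preview_noise_integrable preview_sq_integrable)

lemma init_integrable: "integrable (Pr S) (init S)"
  by (rule square_integrable_imp_integrable[OF init_measurable init_sq])

lemma preview_value_init_integrable:
  "integrable (Pr S) (\<lambda>\<omega>. preview_value S 0 \<omega> (init S \<omega>))"
  unfolding preview_value_def
  using past_preview_uncorrelated[OF init_measurable_past init_integrable, of 0 0] init_sq
  by (simp add: mult.commute[of "preview S 0 _"])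

section \<open>The closed loop\<close>

lemma zeta_measurable_past: "zeta S t \<in> borel_measurable (past t)"
proof (induction t)
  case 0
  show ?case
    by (simp add: init_measurable_past cong: measurable_cong)
next
  case (Suc t)
  have [measurable]: "zeta S t \<in> borel_measurable (past (Suc t))"
    "noise S t \<in> borel_measurable (past (Suc t))"
    by (auto intro: measurable_past_mono[OF Suc] noise_measurable_past)
  show ?case
    by (simp cong: measurable_cong)
qed

lemma zeta_measurable: "t \<le> Suc (hor S) \<Longrightarrow> zeta S t \<in> borel_measurable (Pr S)"
  by (rule measurable_past_imp[OF zeta_measurable_past])

lemma zeta_sq_integrable: "t \<le> Suc (hor S) \<Longrightarrow> integrable (Pr S) (\<lambda>\<omega>. (zeta S t \<omega>)\<^sup>2)"
proof (induction t)
  case 0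
  show ?case by (simp add: init_sq)
next
  case (Suc t)
  then have t: "t \<le> hor S" and IH: "integrable (Pr S) (\<lambda>\<omega>. (zeta S t \<omega>)\<^sup>2)"
    by auto
  have "integrable (Pr S) (zeta S t)"
    by (rule square_integrable_imp_integrable[OF zeta_measurable IH]) (use t in simp)
  note uncorrelated = past_noise_uncorrelated(1)[OF t zeta_measurable_past this]
  have "(zeta S (Suc t) \<omega>)\<^sup>2 = (gain S)\<^sup>2 * (zeta S t \<omega>)\<^sup>2
      + 2 * gain S * (zeta S t \<omega> * noise S t \<omega>) + (noise S t \<omega>)\<^sup>2" for \<omega>
    unfolding zeta.simps by algebra
  then show ?case
    using uncorrelated IH noise_sq[OF t] by (simp del: zeta.simps)
qed

lemma zeta_integrable: "t \<le> Suc (hor S) \<Longrightarrow> integrable (Pr S) (zeta S t)"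
  by (rule square_integrable_imp_integrable[OF zeta_measurable zeta_sq_integrable])

text \<open>
  Symbol processes are studied without reference to the policies that generate them.  In a closed loop
  the controls are functions of the symbols, so an encoder with access to all states amounts to one
  with access to \<open>x\<^sub>0, w\<^sub>0, ..., w\<^sub>t\<^sub>-\<^sub>1\<close>.
\<close>

definition causal :: "(nat \<Rightarrow> 'w \<Rightarrow> nat) \<Rightarrow> bool" where
  "causal Z \<longleftrightarrow> (\<forall>t\<le>hor S. Z t \<in> past t \<rightarrow>\<^sub>M count_space (alphabet S))"

definition hist :: "(nat \<Rightarrow> 'w \<Rightarrow> nat) \<Rightarrow> nat \<Rightarrow> 'w \<Rightarrow> nat \<Rightarrow> nat" where
  "hist Z t \<omega> = (\<lambda>i\<in>{..<t}. Z i \<omega>)"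

abbreviation histories :: "nat \<Rightarrow> (nat \<Rightarrow> nat) set" where
  "histories t \<equiv> {..<t} \<rightarrow>\<^sub>E alphabet S"

lemma finite_histories [simp]: "finite (histories t)"
  by (intro finite_PiE) auto

lemma PiM_alphabet:
  "finite I \<Longrightarrow> (\<Pi>\<^sub>M i\<in>I. count_space (alphabet S)) = count_space (I \<rightarrow>\<^sub>E alphabet S)"
  by (rule count_space_PiM_finite) auto

lemma hist_measurable_past:
  assumes "causal Z" "t \<le> Suc s" "t \<le> Suc (hor S)"
  shows "hist Z t \<in> past s \<rightarrow>\<^sub>M count_space (histories t)"
proof -
  have "(\<lambda>\<omega>. \<lambda>i\<in>{..<t}. Z i \<omega>) \<in> past s \<rightarrow>\<^sub>M (\<Pi>\<^sub>M i\<in>{..<t}. count_space (alphabet S))"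
  proof (rule measurable_restrict)
    fix i assume i: "i \<in> {..<t}"
    show "Z i \<in> past s \<rightarrow>\<^sub>M count_space (alphabet S)"
      by (rule measurable_past_mono[of _ i])
        (use assms i in \<open>auto simp: causal_def\<close>)
  qed
  then show ?thesis
    unfolding PiM_alphabet[OF finite_lessThan] hist_def[abs_def] .
qed

lemma hist_measurable:
  "causal Z \<Longrightarrow> t \<le> Suc (hor S) \<Longrightarrow> hist Z t \<in> Pr S \<rightarrow>\<^sub>M count_space (histories t)"
  by (rule measurable_past_imp[OF hist_measurable_past[of Z t t]]) auto

lemma hist_in_histories:
  "causal Z \<Longrightarrow> t \<le> Suc (hor S) \<Longrightarrow> \<omega> \<in> space (Pr S) \<Longrightarrow> hist Z t \<omega> \<in> histories t"
  using measurable_space[OF hist_measurable] by simp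

text \<open>
  There are finitely many histories, so a function of the history is bounded.
\<close>

lemma fun_hist_times_integrable:
  fixes g :: "(nat \<Rightarrow> nat) \<Rightarrow> real"
  assumes Z: "causal Z" and t: "t \<le> Suc (hor S)" and f: "integrable (Pr S) f"
  shows "integrable (Pr S) (\<lambda>\<omega>. g (hist Z t \<omega>) * f \<omega>)"
proof -
  have [measurable]: "(\<lambda>\<omega>. g (hist Z t \<omega>)) \<in> borel_measurable (Pr S)"
    by (rule measurable_compose[OF hist_measurable[OF Z t]]) simp
  have [measurable]: "f \<in> borel_measurable (Pr S)"
    using f by simp
  have bound: "\<bar>g (hist Z t \<omega>)\<bar> \<le> (\<Sum>z\<in>histories t. \<bar>g z\<bar>)" if "\<omega> \<in> space (Pr S)" for \<omega>
    by (rule member_le_sum[OF hist_in_histories[OF Z t that], of "\<lambda>z. \<bar>g z\<bar>"]) simp_all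
  have "0 \<le> (\<Sum>z\<in>histories t. \<bar>g z\<bar>)"
    by (rule sum_nonneg) simp
  then have "AE \<omega> in Pr S. norm (g (hist Z t \<omega>) * f \<omega>) \<le> norm ((\<Sum>z\<in>histories t. \<bar>g z\<bar>) * f \<omega>)"
    by (intro AE_I2) (simp add: abs_mult mult_right_mono bound)
  moreover have "integrable (Pr S) (\<lambda>\<omega>. (\<Sum>z\<in>histories t. \<bar>g z\<bar>) * f \<omega>)"
    using f by simp
  ultimately show ?thesis
    by (rule Bochner_Integration.integrable_bound[rotated -1]) simp
qed

lemma fun_hist_integrable:
  fixes g :: "(nat \<Rightarrow> nat) \<Rightarrow> real"
  assumes "causal Z" "t \<le> Suc (hor S)"
  shows "integrable (Pr S) (\<lambda>\<omega>. g (hist Z t \<omega>))"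
  using fun_hist_times_integrable[OF assms, of "\<lambda>_. 1" g] by simp

text \<open>
  Gaps have this form, with \<open>c\<close> the feedback gain; decoding errors too, with \<open>c = 1\<close>.
\<close>

lemma affine_zeta_sq_integrable:
  assumes Z: "causal Z" and t: "t \<le> hor S"
  shows "integrable (Pr S) (\<lambda>\<omega>. (c * zeta S t \<omega> + g (hist Z (Suc t) \<omega>))\<^sup>2)"
proof -
  have "integrable (Pr S) (\<lambda>\<omega>. c\<^sup>2 * (zeta S t \<omega>)\<^sup>2 + 2 * c * (g (hist Z (Suc t) \<omega>) * zeta S t \<omega>)
      + (g (hist Z (Suc t) \<omega>))\<^sup>2)"
    using t by (intro Bochner_Integration.integrable_add integrable_mult_right zeta_sq_integrable
      fun_hist_times_integrable[OF Z] fun_hist_integrable[OF Z, of _ "\<lambda>z. (g z)\<^sup>2"] zeta_integrable) auto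
  moreover have "(c * zeta S t \<omega> + g (hist Z (Suc t) \<omega>))\<^sup>2 =
      c\<^sup>2 * (zeta S t \<omega>)\<^sup>2 + 2 * c * (g (hist Z (Suc t) \<omega>) * zeta S t \<omega>)
      + (g (hist Z (Suc t) \<omega>))\<^sup>2" for \<omega>
    by algebra
  ultimately show ?thesis
    by simp
qed

lemma error_sq_integrable:
  assumes Z: "causal Z" and t: "t \<le> hor S"
  shows "integrable (Pr S) (\<lambda>\<omega>. (zeta S t \<omega> - d (hist Z (Suc t) \<omega>))\<^sup>2)"
  using affine_zeta_sq_integrable[OF assms, of 1 "\<lambda>z. - d z"] by simp

lemma closed_loop_measurable_past:
  assumes E: "admissible_encoder S E" and K: "admissible_controller S K" and t: "t \<le> hor S"
  shows "state S E K t \<in> borel_measurable (past t)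
    \<and> symb S E K t \<in> past t \<rightarrow>\<^sub>M count_space (alphabet S)
    \<and> control S E K t \<in> borel_measurable (past t)"
  using t
proof (induction t rule: less_induct)
  case (less t)
  have prev: "state S E K i \<in> borel_measurable (past t)"
    "symb S E K i \<in> past t \<rightarrow>\<^sub>M count_space (alphabet S)"
    "control S E K i \<in> borel_measurable (past t)" if "i < t" for i
    by (rule measurable_past_mono[of _ i], use less that in force, use that in simp)+
  have st: "state S E K t \<in> borel_measurable (past t)"
  proof (cases t)
    case 0
    then show ?thesis
      by (simp add: init_measurable_past cong: measurable_cong)
  next
    case (Suc s)
    note [measurable] = prev[of s] noise_measurable_past[of s t]
    show ?thesis
      using Suc by (simp cong: measurable_cong)
  qed
  have xs: "(\<lambda>\<omega>. \<lambda>i\<in>{..t}. state S E K i \<omega>) \<in> past t \<rightarrow>\<^sub>M (\<Pi>\<^sub>M i\<in>{..t}. borel)"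
    by (rule measurable_restrict) (use prev st in \<open>auto simp: le_less\<close>)
  have zs: "(\<lambda>\<omega>. \<lambda>i\<in>{..<t}. symb S E K i \<omega>) \<in> past t \<rightarrow>\<^sub>M (\<Pi>\<^sub>M i\<in>{..<t}. count_space (alphabet S))"
    by (rule measurable_restrict) (use prev in auto)
  have "(\<lambda>(x, z). E t x z (restrict K {..<t})) \<in> enc_space S t \<rightarrow>\<^sub>M count_space (alphabet S)"
    using E K less.prems by (auto simp: admissible_encoder_def)
  from measurable_compose[OF measurable_Pair[OF xs zs] this[unfolded enc_space_def]]
  have sy: "symb S E K t \<in> past t \<rightarrow>\<^sub>M count_space (alphabet S)"
    by (subst measurable_cong[OF symb.simps]) simp_all
  have zs': "(\<lambda>\<omega>. \<lambda>i\<in>{..t}. symb S E K i \<omega>) \<in> past t \<rightarrow>\<^sub>M (\<Pi>\<^sub>M i\<in>{..t}. count_space (alphabet S))"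
    by (rule measurable_restrict) (use prev sy in \<open>auto simp: le_less\<close>)
  have us: "(\<lambda>\<omega>. \<lambda>i\<in>{..<t}. control S E K i \<omega>) \<in> past t \<rightarrow>\<^sub>M (\<Pi>\<^sub>M i\<in>{..<t}. borel)"
    by (rule measurable_restrict) (use prev in auto)
  have "(\<lambda>(z, u). K t z u) \<in> ctrl_space S t \<rightarrow>\<^sub>M borel"
    using K less.prems by (auto simp: admissible_controller_def)
  from measurable_compose[OF measurable_Pair[OF zs' us] this[unfolded ctrl_space_def]]
  have "control S E K t \<in> borel_measurable (past t)"
    by (subst measurable_cong[OF control.simps]) simp_all
  with st sy show ?case by blast
qed

lemma symb_causal:
  "admissible_encoder S E \<Longrightarrow> admissible_controller S K \<Longrightarrow> causal (symb S E K)"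
  using closed_loop_measurable_past by (auto simp: causal_def)

lemma control_eq_hist: "control S E K t \<omega> = ctrl_seq K (hist (symb S E K) (Suc t) \<omega>) t"
  unfolding control_eq_ctrl_seq by (rule ctrl_seq_cong) (auto simp: hist_def)

lemma state_eq_hist:
  "state S E K t \<omega> = zeta S t \<omega> + drift S K (hist (symb S E K) (Suc t) \<omega>) t"
  unfolding state_eq_zeta_plus_drift by (simp, rule drift_cong) (auto simp: hist_def)

text \<open>
  The controller knows its own contribution to the state, so the uncertainty in a gap is the
  uncertainty in \<open>\<zeta>\<^sub>t\<close>.
\<close>

lemma gap_eq_hist:
  "control S E K t \<omega> + k * state S E K t \<omega> = k * zeta S t \<omega>
    + (ctrl_seq K (hist (symb S E K) (Suc t) \<omega>) t + k * drift S K (hist (symb S E K) (Suc t) \<omega>) t)"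
  by (simp add: control_eq_hist state_eq_hist distrib_left)

section \<open>Decomposition of the cost\<close>

text \<open>
  The part of the cost that no policy can influence.
\<close>

definition noise_cost :: real where
  "noise_cost = (\<integral>\<omega>. preview_value S 0 \<omega> (init S \<omega>) - pwt S * (init S \<omega>)\<^sup>2
     + (\<Sum>i=0..hor S. preview_cost S i \<omega> + (qwt S + beta S (Suc i)) * (preview S i \<omega>)\<^sup>2) \<partial>Pr S)"

lemma gap_weight_pos: "0 < qwt S + beta S (Suc i)"
  using weights beta_pos[OF weights, of "Suc i"] by simp

lemma path_cost_nonneg: "0 \<le> path_cost S x u"
  unfolding path_cost_def using weights by (intro add_nonneg_nonneg mult_nonneg_nonneg sum_nonneg) auto

text \<open>
  The squares of \<open>path_cost_complete_squares\<close> are expanded around the offsets \<open>r\<^sub>i\<close>.  The mixed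
  terms have mean zero because the gap at time \<open>i\<close> is a function of the past.
\<close>

lemma J_decomposition:
  assumes E: "admissible_encoder S E" and K: "admissible_controller S K"
  shows "J S E K = ennreal (noise_cost + (\<Sum>i=0..hor S. (qwt S + beta S (Suc i))
    * (\<integral>\<omega>. (control S E K i \<omega> + kstar S i * state S E K i \<omega>)\<^sup>2 \<partial>Pr S)))"
proof -
  let ?g = "\<lambda>i \<omega>. control S E K i \<omega> + kstar S i * state S E K i \<omega>"
  let ?D = "\<lambda>i. qwt S + beta S (Suc i)"
  let ?c = "\<lambda>\<omega>. preview_value S 0 \<omega> (init S \<omega>) - pwt S * (init S \<omega>)\<^sup>2
     + (\<Sum>i=0..hor S. preview_cost S i \<omega> + ?D i * (preview S i \<omega>)\<^sup>2)"
  have Z: "causal (symb S E K)"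
    by (rule symb_causal[OF E K])
  have gsq: "integrable (Pr S) (\<lambda>\<omega>. (?g i \<omega>)\<^sup>2)" if "i \<le> hor S" for i
    unfolding gap_eq_hist using affine_zeta_sq_integrable[OF Z that] .
  have gR: "integrable (Pr S) (\<lambda>\<omega>. ?g i \<omega> * preview S i \<omega>)"
    "(\<integral>\<omega>. ?g i \<omega> * preview S i \<omega> \<partial>Pr S) = 0" if i: "i \<le> hor S" for i
  proof -
    have m: "?g i \<in> borel_measurable (past i)"
      using closed_loop_measurable_past[OF E K i] by auto
    have "integrable (Pr S) (?g i)"
      by (rule square_integrable_imp_integrable[OF measurable_past_imp[OF m] gsq]) (use i in auto)
    from past_preview_uncorrelated[OF m this order_refl]
    show "integrable (Pr S) (\<lambda>\<omega>. ?g i \<omega> * preview S i \<omega>)"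
      "(\<integral>\<omega>. ?g i \<omega> * preview S i \<omega> \<partial>Pr S) = 0" by auto
  qed
  have cint: "integrable (Pr S) ?c"
    by (intro Bochner_Integration.integrable_add Bochner_Integration.integrable_diff
      Bochner_Integration.integrable_sum integrable_mult_right preview_value_init_integrable init_sq
      preview_cost_integrable preview_sq_integrable) auto
  have path: "path_cost S (\<lambda>i. state S E K i \<omega>) (\<lambda>i. control S E K i \<omega>) =
      ?c \<omega> + (\<Sum>i=0..hor S. ?D i * ((?g i \<omega>)\<^sup>2 + 2 * (?g i \<omega> * preview S i \<omega>)))" for \<omega>
  proof -
    have "?D i * (?g i \<omega> + preview S i \<omega>)\<^sup>2 = ?D i * (preview S i \<omega>)\<^sup>2
        + ?D i * ((?g i \<omega>)\<^sup>2 + 2 * (?g i \<omega> * preview S i \<omega>))" for i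
      by algebra
    then show ?thesis
      by (subst path_cost_complete_squares[OF weights, of 0 _ _ \<omega>]) (simp_all add: sum.distrib)
  qed
  have int: "integrable (Pr S) (\<lambda>\<omega>. \<Sum>i=0..hor S. ?D i * ((?g i \<omega>)\<^sup>2 + 2 * (?g i \<omega> * preview S i \<omega>)))"
    by (intro Bochner_Integration.integrable_sum integrable_mult_right
      Bochner_Integration.integrable_add gsq gR) auto
  have "(\<integral>\<omega>. (\<Sum>i=0..hor S. ?D i * ((?g i \<omega>)\<^sup>2 + 2 * (?g i \<omega> * preview S i \<omega>))) \<partial>Pr S)
      = (\<Sum>i=0..hor S. ?D i * ((\<integral>\<omega>. (?g i \<omega>)\<^sup>2 \<partial>Pr S) + 2 * 0))"
  proof (subst Bochner_Integration.integral_sum)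
    show "(\<Sum>i=0..hor S. \<integral>\<omega>. ?D i * ((?g i \<omega>)\<^sup>2 + 2 * (?g i \<omega> * preview S i \<omega>)) \<partial>Pr S)
      = (\<Sum>i=0..hor S. ?D i * ((\<integral>\<omega>. (?g i \<omega>)\<^sup>2 \<partial>Pr S) + 2 * 0))"
    proof (rule sum.cong)
      fix i assume "i \<in> {0..hor S}"
      then have i: "i \<le> hor S" by simp
      have "(\<integral>\<omega>. (?g i \<omega>)\<^sup>2 + 2 * (?g i \<omega> * preview S i \<omega>) \<partial>Pr S) = (\<integral>\<omega>. (?g i \<omega>)\<^sup>2 \<partial>Pr S) + 2 * 0"
        by (subst Bochner_Integration.integral_add[OF gsq[OF i] integrable_mult_right[OF gR(1)[OF i]]])
           (simp only: integral_mult_right_zero gR(2)[OF i])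
      then show "(\<integral>\<omega>. ?D i * ((?g i \<omega>)\<^sup>2 + 2 * (?g i \<omega> * preview S i \<omega>)) \<partial>Pr S)
          = ?D i * ((\<integral>\<omega>. (?g i \<omega>)\<^sup>2 \<partial>Pr S) + 2 * 0)"
        by (simp only: integral_mult_right_zero)
    qed simp
  qed (intro integrable_mult_right Bochner_Integration.integrable_add gsq gR; simp)
  then have "(\<integral>\<omega>. path_cost S (\<lambda>i. state S E K i \<omega>) (\<lambda>i. control S E K i \<omega>) \<partial>Pr S)
      = noise_cost + (\<Sum>i=0..hor S. ?D i * (\<integral>\<omega>. (?g i \<omega>)\<^sup>2 \<partial>Pr S))"
    unfolding path noise_cost_def by (subst Bochner_Integration.integral_add[OF cint int]) simp
  moreover have "integrable (Pr S) (\<lambda>\<omega>. path_cost S (\<lambda>i. state S E K i \<omega>) (\<lambda>i. control S E K i \<omega>))"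
    unfolding path by (rule Bochner_Integration.integrable_add[OF cint int])
  ultimately show ?thesis
    unfolding J_def by (subst nn_integral_eq_integral) (auto simp: path_cost_nonneg)
qed

section \<open>The encoder design functional, unnormalized\<close>

lemma quantizer_in_alphabet: "\<epsilon> \<in> quantizers S \<Longrightarrow> \<epsilon> s \<in> alphabet S"
  using measurable_space[of \<epsilon> borel "count_space (alphabet S)" s] by (simp add: quantizers_def)

lemma quantizers_nonempty: "quantizers S \<noteq> {}"
proof -
  have "(\<lambda>_. 1) \<in> quantizers S"
    using nonempty_alphabet by (simp add: quantizers_def)
  then show ?thesis by blast
qed

lemma quantizer_comp_measurable:
  "\<epsilon> \<in> quantizers S \<Longrightarrow> f \<in> borel_measurable M \<Longrightarrow> (\<lambda>\<omega>. \<epsilon> (f \<omega>)) \<in> M \<rightarrow>\<^sub>M count_space (alphabet S)"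
  unfolding quantizers_def by (rule measurable_compose)

definition quantizers_before :: "nat \<Rightarrow> (nat \<Rightarrow> real \<Rightarrow> nat) \<Rightarrow> bool" where
  "quantizers_before t e \<longleftrightarrow> (\<forall>i<t. e i \<in> quantizers S)"

lemma quantizers_before_upd:
  "quantizers_before t e \<Longrightarrow> \<epsilon> \<in> quantizers S \<Longrightarrow> quantizers_before (Suc t) (e(t := \<epsilon>))"
  by (auto simp: quantizers_before_def less_Suc_eq)

lemma hist_event_in_past:
  assumes "quantizers_before t e" "t \<le> Suc s"
  shows "hist_event S t z e \<in> sets (past s)"
proof -
  have "{\<omega> \<in> space (past s). \<forall>i\<in>{..<t}. e i (zeta S i \<omega>) = z i} \<in> sets (past s)"
  proof (rule sets.sets_Collect_finite_All)
    fix i assume i: "i \<in> {..<t}"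
    have "(\<lambda>\<omega>. e i (zeta S i \<omega>)) \<in> past s \<rightarrow>\<^sub>M count_space (alphabet S)"
      by (rule quantizer_comp_measurable, use assms i in \<open>simp add: quantizers_before_def\<close>)
         (rule measurable_past_mono[OF zeta_measurable_past], use assms i in auto)
    then have "(\<lambda>\<omega>. e i (zeta S i \<omega>)) \<in> past s \<rightarrow>\<^sub>M count_space UNIV"
      by (rule measurable_compose) simp
    then show "{\<omega> \<in> space (past s). e i (zeta S i \<omega>) = z i} \<in> sets (past s)"
      by measurable
  qed simp
  moreover have "{\<omega> \<in> space (past s). \<forall>i\<in>{..<t}. e i (zeta S i \<omega>) = z i} = hist_event S t z e"
    by (auto simp: hist_event_def)
  ultimately show ?thesis
    by simp
qed

lemma hist_event_sets:
  assumes "quantizers_before t e" "t \<le> Suc (Suc (hor S))"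
  shows "hist_event S t z e \<in> sets (Pr S)"
  using hist_event_in_past[OF assms] subalgebra_past[of "Suc (hor S)"] by (auto simp: subalgebra_def)

lemma hist_event_upd:
  "hist_event S (Suc t) (z(t := a)) (e(t := \<epsilon>)) =
     {\<omega> \<in> hist_event S t z e. \<epsilon> (zeta S t \<omega>) = a}"
  by (auto simp: hist_event_def less_Suc_eq)

lemma hist_event_0: "hist_event S 0 z e = space (Pr S)"
  by (simp add: hist_event_def)

lemma sum_indicator_hist_event_upd:
  assumes "\<epsilon> \<in> quantizers S"
  shows "(\<Sum>a\<in>alphabet S. indicator (hist_event S (Suc t) (z(t := a)) (e(t := \<epsilon>))) \<omega> :: 'b :: semiring_1)
    = indicator (hist_event S t z e) \<omega>"
proof -
  have "(\<Sum>a\<in>alphabet S. indicator (hist_event S (Suc t) (z(t := a)) (e(t := \<epsilon>))) \<omega> :: 'b)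
      = (\<Sum>a\<in>alphabet S. if \<epsilon> (zeta S t \<omega>) = a then indicator (hist_event S t z e) \<omega> else 0)"
    by (rule sum.cong) (auto simp: hist_event_upd indicator_def)
  then show ?thesis
    using quantizer_in_alphabet[OF assms] by simp
qed

text \<open>
  Multiplying by the probability of the event removes the case distinction for null events, on which
  the value of a conditional expectation is a mere convention.  For this reason \<open>\<Gamma>\<close> is treated below only in
  the combination with the probability of the history.
\<close>

lemma prob_times_cond_expect:
  assumes A: "A \<in> sets (Pr S)" and f: "f \<in> borel_measurable (Pr S)"
  shows "prob A * cond_expect S A f = (\<integral>\<omega>. indicator A \<omega> * f \<omega> \<partial>Pr S)"
proof (cases "prob A = 0")
  case True
  then have "A \<in> null_sets (Pr S)"
    using A by (simp add: null_sets_def emeasure_eq_measure)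
  then have "AE \<omega> in Pr S. \<omega> \<notin> A"
    by (rule AE_not_in)
  then have "AE \<omega> in Pr S. indicator A \<omega> * f \<omega> = 0"
    by eventually_elim simp
  then show ?thesis
    using True by (subst integral_cong_AE[where g="\<lambda>_. 0"]) (use A f in auto)
next
  case False
  then have pos: "0 < prob A"
    by (simp add: zero_less_measure_iff)
  have "uniform_measure (Pr S) A = density (Pr S) (\<lambda>\<omega>. ennreal (indicator A \<omega> / prob A))"
    unfolding uniform_measure_def
    by (rule arg_cong[where f="density (Pr S)"])
       (use pos in \<open>auto simp: fun_eq_iff emeasure_eq_measure indicator_def divide_ennreal simp flip: ennreal_1\<close>)
  then have "cond_expect S A f = (\<integral>\<omega>. (indicator A \<omega> / prob A) *\<^sub>R f \<omega> \<partial>Pr S)"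
    unfolding cond_expect_def using A f by (simp add: integral_density)
  also have "\<dots> = (\<integral>\<omega>. (indicator A \<omega> * f \<omega>) / prob A \<partial>Pr S)"
    by (simp add: mult.commute)
  finally show ?thesis
    using pos by simp
qed

lemma lam_nonneg: "0 \<le> lam S t"
  using gap_weight_pos[of t] by (simp add: lam_eq[OF weights])

lemma Gam_nonneg: "0 \<le> Gam S t \<epsilon> z e"
proof (induction "hor S - t" arbitrary: t \<epsilon> z e rule: less_induct)
  case less
  have "0 \<le> cond_expect S A f" if "\<And>\<omega>. 0 \<le> f \<omega>" for A and f :: "'w \<Rightarrow> real"
    using that by (simp add: cond_expect_def)
  moreover have "0 \<le> (INF \<epsilon>'\<in>quantizers S. Gam S (Suc t) \<epsilon>' z e)" if "t < hor S" for z e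
    by (rule cINF_greatest[OF quantizers_nonempty]) (use less that in auto)
  ultimately show ?case
    by (subst Gam.simps) (auto intro!: add_nonneg_nonneg mult_nonneg_nonneg lam_nonneg)
qed

lemma Gam_star_nonneg: "0 \<le> Gam_star S t z e"
  unfolding Gam_star_def by (rule cINF_greatest[OF quantizers_nonempty Gam_nonneg])

lemma Gam_star_le: "\<epsilon> \<in> quantizers S \<Longrightarrow> Gam_star S t z e \<le> Gam S t \<epsilon> z e"
  unfolding Gam_star_def by (rule cINF_lower) (auto intro!: bdd_belowI[of _ 0] Gam_nonneg)

lemma indicator_error_integrable:
  assumes "t \<le> hor S" "A \<in> sets (Pr S)"
  shows "integrable (Pr S) (\<lambda>\<omega>. indicator A \<omega> * (zeta S t \<omega> - c)\<^sup>2)"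
proof -
  have "integrable (Pr S) (\<lambda>\<omega>. (zeta S t \<omega>)\<^sup>2 - 2 * c * zeta S t \<omega> + c\<^sup>2)"
    using zeta_sq_integrable[of t] zeta_integrable[of t] assms by simp
  then have "integrable (Pr S) (\<lambda>\<omega>. (zeta S t \<omega> - c)\<^sup>2)"
    by (rule back_subst[of "integrable (Pr S)"]) (auto simp: power2_diff)
  from integrable_mult_indicator[OF assms(2) this] show ?thesis
    by simp
qed

definition hist_error :: "nat \<Rightarrow> (nat \<Rightarrow> nat) \<Rightarrow> (nat \<Rightarrow> real \<Rightarrow> nat) \<Rightarrow> real \<Rightarrow> real" where
  "hist_error t z e c =
     (\<integral>\<omega>. indicator (hist_event S (Suc t) z e) \<omega> * (zeta S t \<omega> - c)\<^sup>2 \<partial>Pr S)"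

lemma zeta_hat_centered:
  assumes "t \<le> hor S" "quantizers_before (Suc t) e"
  shows "(\<integral>\<omega>. indicator (hist_event S (Suc t) z e) \<omega> * (zeta S t \<omega> - zeta_hat S t z e) \<partial>Pr S) = 0"
proof -
  let ?A = "hist_event S (Suc t) z e"
  have A: "?A \<in> sets (Pr S)"
    using assms by (intro hist_event_sets) auto
  have int: "integrable (Pr S) (\<lambda>\<omega>. indicator ?A \<omega> * zeta S t \<omega>)"
    using integrable_mult_indicator[OF A zeta_integrable[of t]] assms by simp
  have "(\<integral>\<omega>. indicator ?A \<omega> * (zeta S t \<omega> - zeta_hat S t z e) \<partial>Pr S) =
      (\<integral>\<omega>. indicator ?A \<omega> * zeta S t \<omega> - zeta_hat S t z e * indicator ?A \<omega> \<partial>Pr S)"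
    by (simp add: algebra_simps)
  also have "\<dots> = (\<integral>\<omega>. indicator ?A \<omega> * zeta S t \<omega> \<partial>Pr S) - zeta_hat S t z e * prob ?A"
    using A int sets.sets_into_space[OF A]
    by (subst Bochner_Integration.integral_diff) (auto simp: emeasure_eq_measure Int_absorb1 Int_absorb2)
  also have "\<dots> = 0"
    using prob_times_cond_expect[OF A zeta_measurable[of t]] assms by (simp add: zeta_hat_def mult.commute)
  finally show ?thesis .
qed

text \<open>
  The mean minimizes the mean squared error: expand around the mean; the mixed term vanishes by
  \<open>zeta_hat_centered\<close>.
\<close>

lemma zeta_hat_minimizes:
  assumes "t \<le> hor S" "quantizers_before (Suc t) e"
  shows "hist_error t z e (zeta_hat S t z e) \<le> hist_error t z e c"
proof -
  let ?A = "hist_event S (Suc t) z e" and ?m = "zeta_hat S t z e"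
  have A: "?A \<in> sets (Pr S)"
    using assms by (intro hist_event_sets) auto
  have i1: "integrable (Pr S) (\<lambda>\<omega>. indicator ?A \<omega> * (zeta S t \<omega> - ?m)\<^sup>2)"
    using indicator_error_integrable[OF assms(1) A] .
  have i2: "integrable (Pr S) (\<lambda>\<omega>. indicator ?A \<omega> * (zeta S t \<omega> - ?m))"
    using integrable_mult_indicator[OF A Bochner_Integration.integrable_diff[OF zeta_integrable[of t] integrable_const[of ?m]]] assms
    by simp
  have "0 = (\<integral>\<omega>. 2 * (?m - c) * (indicator ?A \<omega> * (zeta S t \<omega> - ?m)) \<partial>Pr S)"
    using zeta_hat_centered[OF assms, of z] by (simp only: integral_mult_right_zero mult_zero_right)
  then have "hist_error t z e ?m =
    (\<integral>\<omega>. indicator ?A \<omega> * (zeta S t \<omega> - ?m)\<^sup>2 + 2 * (?m - c) * (indicator ?A \<omega> * (zeta S t \<omega> - ?m)) \<partial>Pr S)"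
    unfolding hist_error_def
    by (subst Bochner_Integration.integral_add[OF i1 integrable_mult_right[OF i2]]) simp
  also have "\<dots> \<le> hist_error t z e c"
    unfolding hist_error_def
  proof (rule integral_mono)
    show "integrable (Pr S) (\<lambda>\<omega>. indicator ?A \<omega> * (zeta S t \<omega> - c)\<^sup>2)"
      using indicator_error_integrable[OF assms(1) A] .
    fix \<omega>
    have "(zeta S t \<omega> - ?m)\<^sup>2 + 2 * (?m - c) * (zeta S t \<omega> - ?m) + (?m - c)\<^sup>2 = (zeta S t \<omega> - c)\<^sup>2"
      by algebra
    moreover have "0 \<le> (?m - c)\<^sup>2"
      by simp
    ultimately have "(zeta S t \<omega> - ?m)\<^sup>2 + 2 * (?m - c) * (zeta S t \<omega> - ?m) \<le> (zeta S t \<omega> - c)\<^sup>2"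
      by linarith
    then show "indicator ?A \<omega> * (zeta S t \<omega> - ?m)\<^sup>2 + 2 * (?m - c) * (indicator ?A \<omega> * (zeta S t \<omega> - ?m))
        \<le> indicator ?A \<omega> * (zeta S t \<omega> - c)\<^sup>2"
      by (simp add: indicator_def)
  qed (intro Bochner_Integration.integrable_add i1 integrable_mult_right[OF i2])
  finally show ?thesis .
qed

text \<open>
  The unnormalized recursion: the event of a history is split according to the symbol sent next, on
  each piece of which that symbol is constant in the integrands that define \<open>\<Gamma>\<close>.
\<close>

lemma prob_times_Gam:
  assumes t: "t \<le> hor S" and e: "quantizers_before t e" and \<epsilon>: "\<epsilon> \<in> quantizers S"
  shows "prob (hist_event S t z e) * Gam S t \<epsilon> z e =
    (\<Sum>a\<in>alphabet S.
       lam S t * hist_error t (z(t := a)) (e(t := \<epsilon>)) (zeta_hat S t (z(t := a)) (e(t := \<epsilon>)))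
       + (if t < hor S then prob (hist_event S (Suc t) (z(t := a)) (e(t := \<epsilon>)))
            * Gam_star S (Suc t) (z(t := a)) (e(t := \<epsilon>)) else 0))"
proof -
  let ?H = "hist_event S t z e" and ?H' = "\<lambda>a. hist_event S (Suc t) (z(t := a)) (e(t := \<epsilon>))"
  have H: "?H \<in> sets (Pr S)"
    using e t by (intro hist_event_sets) auto
  have H': "?H' a \<in> sets (Pr S)" for a
    using t by (intro hist_event_sets quantizers_before_upd e \<epsilon>) auto
  have [measurable]: "zeta S t \<in> borel_measurable (Pr S)"
    by (rule zeta_measurable) (use t in simp)
  have sym: "(\<lambda>\<omega>. \<epsilon> (zeta S t \<omega>)) \<in> Pr S \<rightarrow>\<^sub>M count_space (alphabet S)"
    by (rule quantizer_comp_measurable[OF \<epsilon>]) simp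
  have [measurable]: "(\<lambda>\<omega>. g (\<epsilon> (zeta S t \<omega>))) \<in> borel_measurable (Pr S)" for g :: "nat \<Rightarrow> real"
    by (rule measurable_compose[OF sym]) simp
  \<comment> \<open>Both summands of \<open>\<Gamma>\<close> depend on the symbol sent through \<open>z(t := a)\<close> only.\<close>
  have split: "prob ?H * cond_expect S ?H (\<lambda>\<omega>. f (\<epsilon> (zeta S t \<omega>)) \<omega>)
      = (\<Sum>a\<in>alphabet S. \<integral>\<omega>. indicator (?H' a) \<omega> * f a \<omega> \<partial>Pr S)"
    if m: "(\<lambda>\<omega>. f (\<epsilon> (zeta S t \<omega>)) \<omega>) \<in> borel_measurable (Pr S)"
      and i: "\<And>a. a \<in> alphabet S \<Longrightarrow> integrable (Pr S) (\<lambda>\<omega>. indicator (?H' a) \<omega> * f a \<omega>)"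
    for f :: "nat \<Rightarrow> 'w \<Rightarrow> real"
  proof -
    have eq: "indicator ?H \<omega> * f (\<epsilon> (zeta S t \<omega>)) \<omega> = (\<Sum>a\<in>alphabet S. indicator (?H' a) \<omega> * f a \<omega>)" for \<omega>
      unfolding sum_indicator_hist_event_upd[OF \<epsilon>, of t z e, symmetric] sum_distrib_right
      by (rule sum.cong) (auto simp: hist_event_upd indicator_def)
    show ?thesis
      unfolding prob_times_cond_expect[OF H m] eq by (rule Bochner_Integration.integral_sum) (rule i)
  qed
  have "prob ?H * cond_expect S ?H (\<lambda>\<omega>. (zeta S t \<omega> - zeta_hat S t (z(t := \<epsilon> (zeta S t \<omega>))) (e(t := \<epsilon>)))\<^sup>2)
    = (\<Sum>a\<in>alphabet S. hist_error t (z(t := a)) (e(t := \<epsilon>)) (zeta_hat S t (z(t := a)) (e(t := \<epsilon>))))"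
    unfolding hist_error_def
    by (rule split[of "\<lambda>a \<omega>. (zeta S t \<omega> - zeta_hat S t (z(t := a)) (e(t := \<epsilon>)))\<^sup>2"])
       (measurable, rule indicator_error_integrable[OF t H'])
  moreover have "prob ?H * cond_expect S ?H (\<lambda>\<omega>. Gam_star S (Suc t) (z(t := \<epsilon> (zeta S t \<omega>))) (e(t := \<epsilon>)))
    = (\<Sum>a\<in>alphabet S. prob (?H' a) * Gam_star S (Suc t) (z(t := a)) (e(t := \<epsilon>)))"
    by (subst split[of "\<lambda>a \<omega>. Gam_star S (Suc t) (z(t := a)) (e(t := \<epsilon>))"])
       (use H' in \<open>auto simp: emeasure_eq_measure Int_absorb1 Int_absorb2 sets.sets_into_space\<close>)
  moreover have "prob ?H * (lam S t * x + y) = lam S t * (prob ?H * x) + prob ?H * y" for x y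
    by algebra
  ultimately show ?thesis
    by (subst Gam.simps, fold Gam_star_def) (simp add: sum.distrib sum_distrib_left)
qed

section \<open>Lower bound for causal encoders\<close>

lemma decoder_measurable_both:
  assumes "t \<le> hor S"
  shows "decoder_value S d t z \<in> borel_measurable borel
    \<and> (\<forall>a. decoder_stage S d t z a \<in> borel_measurable borel)"
  using assms
proof (induction "hor S - t" arbitrary: t z rule: less_induct)
  case less
  have stage: "decoder_stage S d t z a \<in> borel_measurable borel" for a
  proof (cases "t < hor S")
    case True
    then have [measurable]: "decoder_value S d (Suc t) (z(t := a)) \<in> borel_measurable borel"
      using less by auto
    have [measurable]: "noise S t \<in> borel_measurable (Pr S)"
      by (rule noise_measurable) (use True in simp)
    show ?thesis
      using True unfolding decoder_stage_def[abs_def] by simp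
  qed (simp add: decoder_stage_def[abs_def])
  moreover have "decoder_value S d t z \<in> borel_measurable borel"
    unfolding decoder_value_eq[abs_def] by (rule borel_measurable_INF) (simp_all add: stage)
  ultimately show ?case
    by blast
qed

lemma decoder_measurable:
  assumes "t \<le> hor S"
  shows "decoder_value S d t z \<in> borel_measurable borel"
    and "decoder_stage S d t z a \<in> borel_measurable borel"
  using decoder_measurable_both[OF assms] by auto

lemma decoder_value_le_stage: "a \<in> alphabet S \<Longrightarrow> decoder_value S d t z s \<le> decoder_stage S d t z a s"
  unfolding decoder_value_eq by (rule INF_lower)

text \<open>
  Ties are broken by taking the least optimal symbol, which keeps the choice measurable.
\<close>

definition best_symbol :: "(nat \<Rightarrow> (nat \<Rightarrow> nat) \<Rightarrow> real) \<Rightarrow> nat \<Rightarrow> (nat \<Rightarrow> nat) \<Rightarrow> real \<Rightarrow> nat" where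
  "best_symbol d t z s =
     (LEAST a. a \<in> alphabet S \<and> decoder_stage S d t z a s = decoder_value S d t z s)"

lemma best_symbol:
  "best_symbol d t z s \<in> alphabet S"
  "decoder_stage S d t z (best_symbol d t z s) s = decoder_value S d t z s"
proof -
  have "decoder_value S d t z s \<in> (\<lambda>a. decoder_stage S d t z a s) ` alphabet S"
    unfolding decoder_value_eq
    using nonempty_alphabet by (subst cInf_eq_Min) (auto intro!: Min_in)
  then have "\<exists>a. a \<in> alphabet S \<and> decoder_stage S d t z a s = decoder_value S d t z s"
    by auto
  from LeastI_ex[OF this] show "best_symbol d t z s \<in> alphabet S"
    "decoder_stage S d t z (best_symbol d t z s) s = decoder_value S d t z s"
    by (simp_all add: best_symbol_def)
qed

lemma best_symbol_quantizer:
  assumes "t \<le> hor S"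
  shows "best_symbol d t z \<in> quantizers S"
proof -
  note [measurable] = decoder_measurable[OF assms]
  have "best_symbol d t z \<in> borel \<rightarrow>\<^sub>M count_space UNIV"
    unfolding best_symbol_def[abs_def] by measurable
  then have "best_symbol d t z \<in> borel \<rightarrow>\<^sub>M restrict_space (count_space UNIV) (alphabet S)"
    using best_symbol(1) by (intro measurable_restrict_space2) auto
  then show ?thesis
    by (simp add: quantizers_def restrict_count_space)
qed

text \<open>
  The event \<open>A\<close> must belong to the past of time \<open>t\<close>.  It will fix the symbols up to and including time \<open>t\<close>,
  which do not involve \<open>w\<^sub>t\<close>.
\<close>

lemma decoder_value_next:
  assumes t: "t < hor S" and A: "A \<in> sets (past t)"
  shows "(\<integral>\<^sup>+\<omega>. indicator A \<omega> * decoder_value S d (Suc t) z (zeta S (Suc t) \<omega>) \<partial>Pr S) =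
    (\<integral>\<^sup>+\<omega>. indicator A \<omega> * (\<integral>\<^sup>+\<omega>'. decoder_value S d (Suc t) z (gain S * zeta S t \<omega> + noise S t \<omega>') \<partial>Pr S) \<partial>Pr S)"
proof -
  have [measurable]: "decoder_value S d (Suc t) z \<in> borel_measurable borel"
    by (rule decoder_measurable) (use t in simp)
  have [measurable]: "zeta S t \<in> borel_measurable (past t)"
    by (rule zeta_measurable_past)
  have [measurable]: "noise S t \<in> borel_measurable (Pr S)"
    by (rule noise_measurable) (use t in simp)
  note [measurable] = A
  show ?thesis
    using nn_integral_past_noise[of t "\<lambda>(\<omega>, w). indicator A \<omega> * decoder_value S d (Suc t) z (gain S * zeta S t \<omega> + w)"] t
    by (simp add: nn_integral_cmult)
qed

text \<open>
  Backward induction.  The quantizer that sends the best symbol for the fixed decoder is a competitor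
  in the infimum defining \<open>\<Gamma>\<^sup>*\<close>.  At the present step its error with the conditional mean is at most
  its error with the decoder, and the later steps are covered by the induction hypothesis for
  each symbol that may be sent now.
\<close>

lemma Gam_star_le_decoder_value:
  assumes "t \<le> hor S" "quantizers_before t e"
  shows "ennreal (prob (hist_event S t z e) * Gam_star S t z e) \<le>
    (\<integral>\<^sup>+\<omega>. indicator (hist_event S t z e) \<omega> * decoder_value S d t z (zeta S t \<omega>) \<partial>Pr S)"
  using assms
proof (induction "hor S - t" arbitrary: t z e rule: less_induct)
  case less
  note t = less.prems(1) and e = less.prems(2)
  \<comment> \<open>The minimizing choices of symbol for the fixed decoder form a quantizer of \<open>\<zeta>\<^sub>t\<close>.\<close>
  define \<epsilon> where "\<epsilon> = best_symbol d t z"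
  have \<epsilon>: "\<epsilon> \<in> quantizers S"
    unfolding \<epsilon>_def by (rule best_symbol_quantizer[OF t])
  let ?H = "hist_event S t z e" and ?H' = "\<lambda>a. hist_event S (Suc t) (z(t := a)) (e(t := \<epsilon>))"
  have e': "quantizers_before (Suc t) (e(t := \<epsilon>))"
    by (rule quantizers_before_upd[OF e \<epsilon>])
  have H'past: "?H' a \<in> sets (past t)" for a
    by (rule hist_event_in_past[OF e']) simp
  have H' [measurable]: "?H' a \<in> sets (Pr S)" for a
    by (rule hist_event_sets[OF e']) (use t in simp)
  have [measurable]: "zeta S t \<in> borel_measurable (Pr S)"
    by (rule zeta_measurable) (use t in simp)
  note [measurable] = decoder_measurable[OF t]
  have next_measurable: "(\<lambda>\<omega>. \<integral>\<^sup>+\<omega>'. decoder_value S d (Suc t) z' (gain S * zeta S t \<omega> + noise S t \<omega>') \<partial>Pr S)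
      \<in> borel_measurable (Pr S)" if "t < hor S" for z'
  proof -
    have [measurable]: "decoder_value S d (Suc t) z' \<in> borel_measurable borel"
      by (rule decoder_measurable) (use that in simp)
    have [measurable]: "noise S t \<in> borel_measurable (Pr S)"
      by (rule noise_measurable) (use t in simp)
    show ?thesis by measurable
  qed
  have stage: "ennreal (lam S t * hist_error t (z(t := a)) (e(t := \<epsilon>)) (zeta_hat S t (z(t := a)) (e(t := \<epsilon>)))
       + (if t < hor S then prob (?H' a) * Gam_star S (Suc t) (z(t := a)) (e(t := \<epsilon>)) else 0))
     \<le> (\<integral>\<^sup>+\<omega>. indicator (?H' a) \<omega> * decoder_stage S d t z a (zeta S t \<omega>) \<partial>Pr S)" for a
  proof -
    let ?err = "hist_error t (z(t := a)) (e(t := \<epsilon>))"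
    let ?m = "zeta_hat S t (z(t := a)) (e(t := \<epsilon>))" and ?d = "d t (z(t := a))"
    have err_nonneg: "0 \<le> ?err c" for c
      unfolding hist_error_def by simp
    have "ennreal (lam S t * ?err ?m) \<le> ennreal (lam S t * ?err ?d)"
      by (intro ennreal_leI mult_left_mono lam_nonneg zeta_hat_minimizes[OF t e'])
    also have "\<dots> = ennreal (\<integral>\<omega>. lam S t * (indicator (?H' a) \<omega> * (zeta S t \<omega> - ?d)\<^sup>2) \<partial>Pr S)"
      by (simp add: hist_error_def)
    also have "\<dots> = (\<integral>\<^sup>+\<omega>. ennreal (lam S t * (indicator (?H' a) \<omega> * (zeta S t \<omega> - ?d)\<^sup>2)) \<partial>Pr S)"
      by (intro nn_integral_eq_integral[symmetric] integrable_mult_right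
        indicator_error_integrable[OF t H'] AE_I2 mult_nonneg_nonneg lam_nonneg) auto
    also have "\<dots> = (\<integral>\<^sup>+\<omega>. indicator (?H' a) \<omega> * ennreal (lam S t * (zeta S t \<omega> - ?d)\<^sup>2) \<partial>Pr S)"
      by (rule nn_integral_cong) (simp add: indicator_def)
    finally have 1: "ennreal (lam S t * ?err ?m)
      \<le> (\<integral>\<^sup>+\<omega>. indicator (?H' a) \<omega> * ennreal (lam S t * (zeta S t \<omega> - ?d)\<^sup>2) \<partial>Pr S)" .
    show ?thesis
    proof (cases "t < hor S")
      case True
      have "ennreal (prob (?H' a) * Gam_star S (Suc t) (z(t := a)) (e(t := \<epsilon>)))
        \<le> (\<integral>\<^sup>+\<omega>. indicator (?H' a) \<omega> * decoder_value S d (Suc t) (z(t := a)) (zeta S (Suc t) \<omega>) \<partial>Pr S)"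
        by (rule less.hyps) (use True e' in auto)
      also have "\<dots> = (\<integral>\<^sup>+\<omega>. indicator (?H' a) \<omega> * (\<integral>\<^sup>+\<omega>'. decoder_value S d (Suc t) (z(t := a))
          (gain S * zeta S t \<omega> + noise S t \<omega>') \<partial>Pr S) \<partial>Pr S)"
        by (rule decoder_value_next[OF True H'past])
      finally show ?thesis
        using True 1 next_measurable[OF True, of "z(t := a)"] err_nonneg lam_nonneg[of t]
        by (simp add: decoder_stage_def distrib_left nn_integral_add Gam_star_nonneg add_mono)
    next
      case False
      then show ?thesis
        using 1 by (simp add: decoder_stage_def)
    qed
  qed
  have "ennreal (prob ?H * Gam_star S t z e) \<le> ennreal (prob ?H * Gam S t \<epsilon> z e)"
    by (intro ennreal_leI mult_left_mono Gam_star_le[OF \<epsilon>] measure_nonneg)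
  also have "\<dots> = (\<Sum>a\<in>alphabet S. ennreal (
       lam S t * hist_error t (z(t := a)) (e(t := \<epsilon>)) (zeta_hat S t (z(t := a)) (e(t := \<epsilon>)))
       + (if t < hor S then prob (?H' a) * Gam_star S (Suc t) (z(t := a)) (e(t := \<epsilon>)) else 0)))"
    unfolding prob_times_Gam[OF t e \<epsilon>]
    by (intro sum_ennreal[symmetric] add_nonneg_nonneg mult_nonneg_nonneg lam_nonneg)
       (auto simp: hist_error_def Gam_star_nonneg)
  also have "\<dots> \<le> (\<Sum>a\<in>alphabet S. \<integral>\<^sup>+\<omega>. indicator (?H' a) \<omega> * decoder_stage S d t z a (zeta S t \<omega>) \<partial>Pr S)"
    by (intro sum_mono stage)
  also have "\<dots> = (\<integral>\<^sup>+\<omega>. (\<Sum>a\<in>alphabet S. indicator (?H' a) \<omega> * decoder_stage S d t z a (zeta S t \<omega>)) \<partial>Pr S)"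
    by (rule nn_integral_sum[symmetric]) measurable
  also have "\<dots> = (\<integral>\<^sup>+\<omega>. indicator ?H \<omega> * decoder_value S d t z (zeta S t \<omega>) \<partial>Pr S)"
  proof (rule nn_integral_cong)
    fix \<omega>
    have "(\<Sum>a\<in>alphabet S. indicator (?H' a) \<omega> * decoder_stage S d t z a (zeta S t \<omega>))
        = (\<Sum>a\<in>alphabet S. indicator (?H' a) \<omega> * decoder_value S d t z (zeta S t \<omega>))"
    proof (rule sum.cong)
      fix a
      show "indicator (?H' a) \<omega> * decoder_stage S d t z a (zeta S t \<omega>)
        = indicator (?H' a) \<omega> * decoder_value S d t z (zeta S t \<omega>)"
      proof (cases "\<omega> \<in> ?H' a")
        case True
        then have "a = best_symbol d t z (zeta S t \<omega>)"
          by (auto simp: hist_event_upd \<epsilon>_def)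
        then show ?thesis
          using best_symbol(2) by metis
      qed simp
    qed simp
    then show "(\<Sum>a\<in>alphabet S. indicator (?H' a) \<omega> * decoder_stage S d t z a (zeta S t \<omega>))
        = indicator ?H \<omega> * decoder_value S d t z (zeta S t \<omega>)"
      by (simp add: sum_indicator_hist_event_upd[OF \<epsilon>] flip: sum_distrib_right)
  qed
  finally show ?case .
qed

lemma hist_Suc: "hist Z (Suc t) \<omega> = (hist Z t \<omega>)(t := Z t \<omega>)"
  by (auto simp: hist_def fun_eq_iff less_Suc_eq)

text \<open>
  The dynamic programming inequality: whatever symbol the encoder sends at time \<open>t\<close>, and whatever it
  bases its choice on, the cost-to-go is at most that of this symbol, and the expected cost-to-go
  after it is obtained by averaging over \<open>w\<^sub>t\<close> alone.
\<close>

lemma decoder_value_le_error: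
  assumes Z: "causal Z" and t: "t \<le> hor S"
  shows "(\<integral>\<^sup>+\<omega>. decoder_value S d t (hist Z t \<omega>) (zeta S t \<omega>) \<partial>Pr S) \<le>
    (\<Sum>i=t..hor S. \<integral>\<^sup>+\<omega>. ennreal (lam S i * (zeta S i \<omega> - d i (hist Z (Suc i) \<omega>))\<^sup>2) \<partial>Pr S)"
  using t
proof (induction "hor S - t" arbitrary: t rule: less_induct)
  case less
  note t = less.prems
  let ?err = "\<lambda>i \<omega>. ennreal (lam S i * (zeta S i \<omega> - d i (hist Z (Suc i) \<omega>))\<^sup>2)"
  let ?next = "\<lambda>\<omega>. if t < hor S then \<integral>\<^sup>+\<omega>'. decoder_value S d (Suc t) (hist Z (Suc t) \<omega>)
      (gain S * zeta S t \<omega> + noise S t \<omega>') \<partial>Pr S else 0"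
  have [measurable]: "hist Z (Suc t) \<in> Pr S \<rightarrow>\<^sub>M count_space (histories (Suc t))"
    "(\<lambda>\<omega>. d t (hist Z (Suc t) \<omega>)) \<in> borel_measurable (Pr S)"
    "zeta S t \<in> borel_measurable (Pr S)" "noise S t \<in> borel_measurable (Pr S)"
    using t hist_measurable[OF Z, of "Suc t"] measurable_compose[OF hist_measurable[OF Z, of "Suc t"], of "d t" borel]
    by (auto intro: zeta_measurable noise_measurable)
  have V: "decoder_value S d (Suc t) z \<in> borel_measurable borel" if "t < hor S" for z
    by (rule decoder_measurable) (use that in simp)
  have "(\<integral>\<^sup>+\<omega>. decoder_value S d t (hist Z t \<omega>) (zeta S t \<omega>) \<partial>Pr S) \<le> (\<integral>\<^sup>+\<omega>. ?err t \<omega> + ?next \<omega> \<partial>Pr S)"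
  proof (rule nn_integral_mono)
    fix \<omega> assume "\<omega> \<in> space (Pr S)"
    moreover have "Z t \<in> past t \<rightarrow>\<^sub>M count_space (alphabet S)"
      using Z t unfolding causal_def by blast
    ultimately have "Z t \<omega> \<in> alphabet S"
      using measurable_space[of "Z t" "past t" "count_space (alphabet S)" \<omega>] by simp
    from decoder_value_le_stage[OF this, of d t "hist Z t \<omega>" "zeta S t \<omega>"]
    show "decoder_value S d t (hist Z t \<omega>) (zeta S t \<omega>) \<le> ?err t \<omega> + ?next \<omega>"
      by (simp only: decoder_stage_def hist_Suc)
  qed
  also have "\<dots> = (\<integral>\<^sup>+\<omega>. ?err t \<omega> \<partial>Pr S) + (\<integral>\<^sup>+\<omega>. ?next \<omega> \<partial>Pr S)"
  proof (rule nn_integral_add)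
    show "?next \<in> borel_measurable (Pr S)"
    proof (cases "t < hor S")
      case True
      note [measurable] = V[OF True]
      have "(\<lambda>\<omega>. \<integral>\<^sup>+\<omega>'. decoder_value S d (Suc t) (hist Z (Suc t) \<omega>)
        (gain S * zeta S t \<omega> + noise S t \<omega>') \<partial>Pr S) \<in> borel_measurable (Pr S)"
        by (rule measurable_compose_countable'[where g="hist Z (Suc t)" and I="histories (Suc t)"])
           (auto intro: countable_finite)
      then show ?thesis
        using True by simp
    qed simp
  qed measurable
  also have "\<dots> \<le> (\<integral>\<^sup>+\<omega>. ?err t \<omega> \<partial>Pr S) + (\<Sum>i=Suc t..hor S. \<integral>\<^sup>+\<omega>. ?err i \<omega> \<partial>Pr S)"
  proof (rule add_left_mono)
    show "(\<integral>\<^sup>+\<omega>. ?next \<omega> \<partial>Pr S) \<le> (\<Sum>i=Suc t..hor S. \<integral>\<^sup>+\<omega>. ?err i \<omega> \<partial>Pr S)"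
    proof (cases "t < hor S")
      case True
      note [measurable] = V[OF True] zeta_measurable_past
      have h [measurable]: "hist Z (Suc t) \<in> past t \<rightarrow>\<^sub>M count_space (histories (Suc t))"
        by (rule hist_measurable_past[OF Z]) (use t in auto)
      have "(\<lambda>(\<omega>, w). decoder_value S d (Suc t) (hist Z (Suc t) \<omega>) (gain S * zeta S t \<omega> + w))
          \<in> borel_measurable (past t \<Otimes>\<^sub>M borel)"
        unfolding case_prod_beta
        by (rule measurable_compose_countable'[where g="\<lambda>p. hist Z (Suc t) (fst p)" and I="histories (Suc t)"])
           (auto intro: countable_finite)
      from nn_integral_past_noise[OF t this]
      have "(\<integral>\<^sup>+\<omega>. ?next \<omega> \<partial>Pr S)
          = (\<integral>\<^sup>+\<omega>. decoder_value S d (Suc t) (hist Z (Suc t) \<omega>) (zeta S (Suc t) \<omega>) \<partial>Pr S)"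
        using True by simp
      also have "\<dots> \<le> (\<Sum>i=Suc t..hor S. \<integral>\<^sup>+\<omega>. ?err i \<omega> \<partial>Pr S)"
        by (rule less.hyps) (use True in auto)
      finally show ?thesis .
    qed simp
  qed
  also have "\<dots> = (\<Sum>i=t..hor S. \<integral>\<^sup>+\<omega>. ?err i \<omega> \<partial>Pr S)"
    using t by (simp add: sum.atLeast_Suc_atMost)
  finally show ?case .
qed

text \<open>
  The two bounds on the cost-to-go are combined at time 0, where the history is empty and has
  probability 1.
\<close>

lemma Gam_star_le_causal_error:
  assumes Z: "causal Z"
  shows "Gam_star S 0 (\<lambda>_. undefined) e \<le>
    (\<Sum>i=0..hor S. lam S i * (\<integral>\<omega>. (zeta S i \<omega> - d i (hist Z (Suc i) \<omega>))\<^sup>2 \<partial>Pr S))"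
proof -
  let ?r = "\<lambda>i. lam S i * (\<integral>\<omega>. (zeta S i \<omega> - d i (hist Z (Suc i) \<omega>))\<^sup>2 \<partial>Pr S)"
  have nonneg: "0 \<le> ?r i" for i
    by (intro mult_nonneg_nonneg lam_nonneg) simp
  have hist0: "hist Z 0 \<omega> = (\<lambda>_. undefined)" for \<omega>
    by (simp add: hist_def restrict_def)
  have "ennreal (Gam_star S 0 (\<lambda>_. undefined) e) \<le> (\<integral>\<^sup>+\<omega>. decoder_value S d 0 (hist Z 0 \<omega>) (zeta S 0 \<omega>) \<partial>Pr S)"
    using Gam_star_le_decoder_value[of 0 e "\<lambda>_. undefined" d]
    by (simp add: quantizers_before_def hist_event_0 prob_space hist0 cong: nn_integral_cong)
  also have "\<dots> \<le> (\<Sum>i=0..hor S. \<integral>\<^sup>+\<omega>. ennreal (lam S i * (zeta S i \<omega> - d i (hist Z (Suc i) \<omega>))\<^sup>2) \<partial>Pr S)"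
    by (rule decoder_value_le_error[OF Z]) simp
  also have "\<dots> = (\<Sum>i=0..hor S. ennreal (?r i))"
  proof (rule sum.cong)
    fix i assume "i \<in> {0..hor S}"
    then have int: "integrable (Pr S) (\<lambda>\<omega>. lam S i * (zeta S i \<omega> - d i (hist Z (Suc i) \<omega>))\<^sup>2)"
      by (intro integrable_mult_right error_sq_integrable[OF Z]) simp
    show "(\<integral>\<^sup>+\<omega>. ennreal (lam S i * (zeta S i \<omega> - d i (hist Z (Suc i) \<omega>))\<^sup>2) \<partial>Pr S) = ennreal (?r i)"
      by (subst nn_integral_eq_integral[OF int]) (auto intro!: AE_I2 mult_nonneg_nonneg lam_nonneg)
  qed simp
  also have "\<dots> = ennreal (\<Sum>i=0..hor S. ?r i)"
    by (rule sum_ennreal) (rule nonneg)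
  finally show ?thesis
    by (subst (asm) ennreal_le_iff) (auto intro!: sum_nonneg nonneg)
qed

section \<open>Quantizer rules attaining the infimum\<close>

text \<open>
  The symbols sent when the rule is applied to \<open>\<zeta>\<^sub>0, \<zeta>\<^sub>1, ...\<close>, as a process that makes no reference to a
  controller.
\<close>

definition realized_symbols :: "quantizer_rule \<Rightarrow> (nat \<Rightarrow> 'w \<Rightarrow> nat) \<Rightarrow> bool" where
  "realized_symbols eps Z \<longleftrightarrow>
     causal Z \<and> (\<forall>t \<omega>. Z t \<omega> = realized_quantizer eps (\<lambda>i. Z i \<omega>) t (zeta S t \<omega>))"

definition realized_quantizers :: "quantizer_rule \<Rightarrow> (nat \<Rightarrow> nat) \<Rightarrow> nat \<Rightarrow> nat \<Rightarrow> real \<Rightarrow> nat" where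
  "realized_quantizers eps z t = (\<lambda>i\<in>{..<t}. realized_quantizer eps z i)"

definition symbol_estimate :: "quantizer_rule \<Rightarrow> nat \<Rightarrow> (nat \<Rightarrow> nat) \<Rightarrow> real" where
  "symbol_estimate eps t z = zeta_hat S t z (realized_quantizers eps z (Suc t))"

lemma realized_quantizer_in_quantizers:
  assumes eps: "arg_inf_rule S eps" and "t \<le> hor S" "\<And>i. i < t \<Longrightarrow> z i \<in> alphabet S"
  shows "realized_quantizer eps z t \<in> quantizers S"
  using assms(2,3)
proof (induction t rule: less_induct)
  case (less t)
  have "restrict z {..<t} \<in> histories t"
    using less.prems by auto
  moreover have "(\<lambda>i\<in>{..<t}. realized_quantizer eps z i) \<in> {..<t} \<rightarrow>\<^sub>E quantizers S"
    using less by auto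
  ultimately have "eps t (restrict z {..<t}) (\<lambda>i\<in>{..<t}. realized_quantizer eps z i) \<in> quantizers S"
    using eps less.prems(1) unfolding arg_inf_rule_def by blast
  then show ?case
    by (subst realized_quantizer.simps)
qed

lemma realized_quantizers_in_quantizers:
  assumes "arg_inf_rule S eps" "t \<le> Suc (hor S)" "z \<in> histories t"
  shows "realized_quantizers eps z t \<in> {..<t} \<rightarrow>\<^sub>E quantizers S"
  unfolding realized_quantizers_def restrict_PiE_iff
proof
  fix i assume i: "i \<in> {..<t}"
  show "realized_quantizer eps z i \<in> quantizers S"
  proof (rule realized_quantizer_in_quantizers[OF assms(1)])
    show "z j \<in> alphabet S" if "j < i" for j
      by (rule PiE_mem[OF assms(3)]) (use that i in simp)
  qed (use assms(2) i in simp)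
qed

text \<open>
  The events that enter \<open>\<Gamma>\<close> fix a sequence of quantizers in advance, whereas the rule picks
  quantizers according to the symbols.  Both agree as long as the history is \<open>z\<close>.
\<close>

lemma hist_event_realized:
  assumes Z: "realized_symbols eps Z" and z: "z \<in> histories t"
  shows "hist_event S t z (realized_quantizers eps z t) = {\<omega> \<in> space (Pr S). hist Z t \<omega> = z}"
proof -
  have "(\<forall>i<s. realized_quantizer eps z i (zeta S i \<omega>) = z i) \<longleftrightarrow> (\<forall>i<s. Z i \<omega> = z i)" for s \<omega>
  proof (induction s)
    case (Suc s)
    have "realized_quantizer eps z s (zeta S s \<omega>) = Z s \<omega>" if agree: "\<forall>i<s. Z i \<omega> = z i"
    proof -
      have "realized_quantizer eps z s = realized_quantizer eps (\<lambda>i. Z i \<omega>) s"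
        by (rule realized_quantizer_cong) (simp add: agree)
      moreover have "Z s \<omega> = realized_quantizer eps (\<lambda>i. Z i \<omega>) s (zeta S s \<omega>)"
        using Z unfolding realized_symbols_def by blast
      ultimately show ?thesis by simp
    qed
    then show ?case
      unfolding less_Suc_eq using Suc by metis
  qed simp
  moreover have "hist Z t \<omega> = z \<longleftrightarrow> (\<forall>i<t. Z i \<omega> = z i)" for \<omega>
    using PiE_arb[OF z] by (auto simp: hist_def fun_eq_iff)
  ultimately show ?thesis
    by (auto simp: hist_event_def realized_quantizers_def)
qed

text \<open>
  Backward induction: \<open>prob_times_Gam\<close> is an equality and the rule attains the infimum after every
  history, so the infima unfold into the errors of the quantizers that the rule selects.
\<close>

lemma Gam_star_realized:
  assumes eps: "arg_inf_rule S eps" and Z: "realized_symbols eps Z"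
    and "t \<le> hor S" "z \<in> histories t"
  shows "prob {\<omega> \<in> space (Pr S). hist Z t \<omega> = z} * Gam_star S t z (realized_quantizers eps z t) =
    (\<Sum>i=t..hor S. lam S i * (\<integral>\<omega>. indicator {\<omega> \<in> space (Pr S). hist Z t \<omega> = z} \<omega>
       * (zeta S i \<omega> - symbol_estimate eps i (hist Z (Suc i) \<omega>))\<^sup>2 \<partial>Pr S))"
  using assms(3,4)
proof (induction "hor S - t" arbitrary: t z rule: less_induct)
  case less
  note t = less.prems(1) and z = less.prems(2)
  have cZ: "causal Z"
    using Z by (simp add: realized_symbols_def)
  let ?e = "realized_quantizers eps z t"
  let ?E = "\<lambda>t z. {\<omega> \<in> space (Pr S). hist Z t \<omega> = z}"
  let ?err = "\<lambda>i \<omega>. (zeta S i \<omega> - symbol_estimate eps i (hist Z (Suc i) \<omega>))\<^sup>2"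
  define \<epsilon> where "\<epsilon> = eps t z ?e"
  have e: "?e \<in> {..<t} \<rightarrow>\<^sub>E quantizers S"
    by (rule realized_quantizers_in_quantizers[OF eps]) (use t z in auto)
  then have eb: "quantizers_before t ?e"
    by (auto simp: quantizers_before_def)
  have \<epsilon>: "\<epsilon> \<in> quantizers S" and opt: "Gam S t \<epsilon> z ?e = Gam_star S t z ?e"
    using eps t z e by (auto simp: arg_inf_rule_def \<epsilon>_def)
  have za: "z(t := a) \<in> histories (Suc t)" if "a \<in> alphabet S" for a
    unfolding lessThan_Suc by (rule PiE_fun_upd[OF that z])
  \<comment> \<open>The quantizer used at time \<open>t\<close> is chosen before the symbol \<open>a\<close> is known.\<close>
  have upd: "?e(t := \<epsilon>) = realized_quantizers eps (z(t := a)) (Suc t)" for a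
  proof -
    have "realized_quantizer eps (z(t := a)) i = realized_quantizer eps z i" if "i \<le> t" for i
      by (rule realized_quantizer_cong) (use that in auto)
    moreover have "realized_quantizer eps z t = \<epsilon>"
      using z by (subst realized_quantizer.simps)
        (simp add: \<epsilon>_def realized_quantizers_def PiE_restrict)
    ultimately show ?thesis
      by (auto simp: realized_quantizers_def fun_eq_iff less_Suc_eq)
  qed
  have Ea: "hist_event S (Suc t) (z(t := a)) (?e(t := \<epsilon>)) = ?E (Suc t) (z(t := a))" if "a \<in> alphabet S" for a
    unfolding upd[of a] by (rule hist_event_realized[OF Z za[OF that]])
  have E: "hist_event S t z ?e = ?E t z"
    by (rule hist_event_realized[OF Z z])
  have Eset: "?E s y \<in> sets (Pr S)" if "s \<le> Suc (hor S)" for s y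
  proof -
    have "hist Z s \<in> Pr S \<rightarrow>\<^sub>M count_space UNIV"
      by (rule measurable_compose[OF hist_measurable[OF cZ that]]) simp
    then show ?thesis by measurable
  qed
  have int: "integrable (Pr S) (\<lambda>\<omega>. indicator (?E (Suc t) y) \<omega> * ?err i \<omega>)" if "i \<le> hor S" for i y
    using integrable_mult_indicator[OF Eset error_sq_integrable[OF cZ that]] t by simp
  have stage: "lam S t * hist_error t (z(t := a)) (?e(t := \<epsilon>)) (zeta_hat S t (z(t := a)) (?e(t := \<epsilon>)))
       + (if t < hor S then prob (hist_event S (Suc t) (z(t := a)) (?e(t := \<epsilon>)))
            * Gam_star S (Suc t) (z(t := a)) (?e(t := \<epsilon>)) else 0)
     = (\<Sum>i=t..hor S. lam S i * (\<integral>\<omega>. indicator (?E (Suc t) (z(t := a))) \<omega> * ?err i \<omega> \<partial>Pr S))"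
    if a: "a \<in> alphabet S" for a
  proof -
    have "hist_error t (z(t := a)) (?e(t := \<epsilon>)) (zeta_hat S t (z(t := a)) (?e(t := \<epsilon>)))
        = (\<integral>\<omega>. indicator (?E (Suc t) (z(t := a))) \<omega> * ?err t \<omega> \<partial>Pr S)"
      unfolding hist_error_def Ea[OF a]
      by (rule Bochner_Integration.integral_cong)
         (auto simp: indicator_def symbol_estimate_def upd[of a])
    moreover have "(if t < hor S then prob (hist_event S (Suc t) (z(t := a)) (?e(t := \<epsilon>)))
            * Gam_star S (Suc t) (z(t := a)) (?e(t := \<epsilon>)) else 0)
        = (\<Sum>i=Suc t..hor S. lam S i * (\<integral>\<omega>. indicator (?E (Suc t) (z(t := a))) \<omega> * ?err i \<omega> \<partial>Pr S))"
    proof (cases "t < hor S")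
      case True
      show ?thesis
        unfolding Ea[OF a] unfolding upd[of a]
        using less.hyps[of "Suc t" "z(t := a)"] True za[OF a] by simp
    qed simp
    ultimately show ?thesis
      using t by (simp add: sum.atLeast_Suc_atMost)
  qed
  have "prob (?E t z) * Gam_star S t z ?e =
      (\<Sum>a\<in>alphabet S. \<Sum>i=t..hor S. lam S i * (\<integral>\<omega>. indicator (?E (Suc t) (z(t := a))) \<omega> * ?err i \<omega> \<partial>Pr S))"
    unfolding E[symmetric] opt[symmetric] prob_times_Gam[OF t eb \<epsilon>] by (rule sum.cong[OF refl stage])
  also have "\<dots> = (\<Sum>i=t..hor S. lam S i *
      (\<Sum>a\<in>alphabet S. \<integral>\<omega>. indicator (?E (Suc t) (z(t := a))) \<omega> * ?err i \<omega> \<partial>Pr S))"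
    by (subst sum.swap) (simp add: sum_distrib_left)
  also have "\<dots> = (\<Sum>i=t..hor S. lam S i * (\<integral>\<omega>. indicator (?E t z) \<omega> * ?err i \<omega> \<partial>Pr S))"
  proof (rule sum.cong)
    fix i assume i: "i \<in> {t..hor S}"
    have "(\<Sum>a\<in>alphabet S. \<integral>\<omega>. indicator (?E (Suc t) (z(t := a))) \<omega> * ?err i \<omega> \<partial>Pr S)
        = (\<integral>\<omega>. (\<Sum>a\<in>alphabet S. indicator (?E (Suc t) (z(t := a))) \<omega> * ?err i \<omega>) \<partial>Pr S)"
      by (rule Bochner_Integration.integral_sum[symmetric]) (use i int in auto)
    also have "\<dots> = (\<integral>\<omega>. indicator (?E t z) \<omega> * ?err i \<omega> \<partial>Pr S)"
      unfolding sum_distrib_right[symmetric] E[symmetric] sum_indicator_hist_event_upd[OF \<epsilon>, of t z ?e, symmetric]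
      by (intro Bochner_Integration.integral_cong refl arg_cong2[where f="(*)"] sum.cong)
         (simp add: Ea)
    finally show "lam S i * (\<Sum>a\<in>alphabet S. \<integral>\<omega>. indicator (?E (Suc t) (z(t := a))) \<omega> * ?err i \<omega> \<partial>Pr S)
        = lam S i * (\<integral>\<omega>. indicator (?E t z) \<omega> * ?err i \<omega> \<partial>Pr S)"
      by simp
  qed simp
  finally show ?case .
qed

lemma Gam_star_eq_realized_error:
  assumes eps: "arg_inf_rule S eps" and Z: "realized_symbols eps Z"
  shows "Gam_star S 0 (\<lambda>_. undefined) (\<lambda>_. undefined) =
    (\<Sum>i=0..hor S. lam S i * (\<integral>\<omega>. (zeta S i \<omega> - symbol_estimate eps i (hist Z (Suc i) \<omega>))\<^sup>2 \<partial>Pr S))"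
proof -
  have "{\<omega> \<in> space (Pr S). hist Z 0 \<omega> = (\<lambda>_. undefined)} = space (Pr S)"
    "realized_quantizers eps (\<lambda>_. undefined) 0 = (\<lambda>_. undefined)"
    by (auto simp: hist_def realized_quantizers_def restrict_def)
  with Gam_star_realized[OF assms, of 0 "\<lambda>_. undefined"] show ?thesis
    by (simp add: prob_space cong: Bochner_Integration.integral_cong)
qed

section \<open>Estimation from the received symbols\<close>

lemma admissible_zeta_encoder:
  assumes eps: "arg_inf_rule S eps"
  shows "admissible_encoder S (zeta_encoder S eps)"
  unfolding admissible_encoder_def
proof (intro allI impI)
  fix K :: controller and t assume t: "t \<le> hor S"
  let ?K = "restrict K {..<t} :: controller"
  \<comment> \<open>Symbol histories are finitely many, so measurability may be checked for each of them.\<close>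
  have "(\<lambda>p. realized_quantizer eps (snd p) t (fst p t - drift S ?K (snd p) t))
      \<in> (\<Pi>\<^sub>M i\<in>{..t}. borel) \<Otimes>\<^sub>M count_space (histories t) \<rightarrow>\<^sub>M count_space (alphabet S)"
  proof (rule measurable_compose_countable'[where g=snd and I="histories t"
        and f="\<lambda>z p. realized_quantizer eps z t (fst p t - drift S ?K z t)"])
    fix z assume z: "z \<in> histories t"
    have "z i \<in> alphabet S" if "i < t" for i
      by (rule PiE_mem[OF z]) (use that in simp)
    then have "realized_quantizer eps z t \<in> quantizers S"
      by (rule realized_quantizer_in_quantizers[OF eps t])
    moreover have "(\<lambda>p. fst p t - drift S ?K z t)
        \<in> borel_measurable ((\<Pi>\<^sub>M i\<in>{..t}. borel) \<Otimes>\<^sub>M count_space (histories t))"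
      using measurable_compose[OF measurable_fst measurable_component_singleton[of t "{..t}"]] by simp
    ultimately show "(\<lambda>p. realized_quantizer eps z t (fst p t - drift S ?K z t))
        \<in> (\<Pi>\<^sub>M i\<in>{..t}. borel) \<Otimes>\<^sub>M count_space (histories t) \<rightarrow>\<^sub>M count_space (alphabet S)"
      by (rule quantizer_comp_measurable)
  qed (simp_all add: countable_finite)
  then show "(\<lambda>(x, z). zeta_encoder S eps t x z ?K) \<in> enc_space S t \<rightarrow>\<^sub>M count_space (alphabet S)"
    unfolding enc_space_def PiM_alphabet[OF finite_lessThan] zeta_encoder_def case_prod_beta .
qed

lemma controls_forgetting_zeta_encoder:
  assumes eps: "arg_inf_rule S eps"
  shows "controls_forgetting S 0 (zeta_encoder S eps)"
  unfolding controls_forgetting_def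
proof (intro conjI admissible_zeta_encoder[OF eps])
  show "\<exists>eps'. \<forall>K. admissible_controller S K \<longrightarrow>
      (\<forall>t\<in>{0<..hor S}. \<forall>z\<in>histories t. zeta_map S (zeta_encoder S eps) K z t =
        eps' t (zeta_law S (zeta_encoder S eps) K 0 z) (restrict z {0..<t})
          (\<lambda>i\<in>{0..<t}. zeta_map S (zeta_encoder S eps) K z i))"
    unfolding zeta_map_zeta_encoder atLeast0LessThan
    by (intro exI[of _ "\<lambda>t \<mu>. eps t"] allI impI ballI realized_quantizer.simps)
qed (simp add: zeta_encoder_def)

lemma realized_symbols_zeta_encoder:
  assumes "arg_inf_rule S eps" "admissible_controller S K"
  shows "realized_symbols eps (symb S (zeta_encoder S eps) K)"
  unfolding realized_symbols_def
  by (intro conjI allI symb_zeta_encoder symb_causal admissible_zeta_encoder assms)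

text \<open>
  Past controls are functions of the symbols, so they carry no additional information.
\<close>

lemma ctrl_data_map:
  "(\<lambda>i\<in>{..t}. symb S E K i \<omega>, \<lambda>i\<in>{..<t}. control S E K i \<omega>) =
     (hist (symb S E K) (Suc t) \<omega>, \<lambda>i\<in>{..<t}. ctrl_seq K (hist (symb S E K) (Suc t) \<omega>) i)"
proof -
  have "control S E K i \<omega> = ctrl_seq K (hist (symb S E K) (Suc t) \<omega>) i" if "i < t" for i
    unfolding control_eq_ctrl_seq by (rule ctrl_seq_cong) (use that in \<open>auto simp: hist_def\<close>)
  then show ?thesis
    by (auto simp: hist_def lessThan_Suc_atMost)
qed

lemma ctrl_data_map_measurable:
  assumes E: "admissible_encoder S E" and K: "admissible_controller S K" and t: "t \<le> hor S"
  shows "(\<lambda>\<omega>. (\<lambda>i\<in>{..t}. symb S E K i \<omega>, \<lambda>i\<in>{..<t}. control S E K i \<omega>)) \<in> past t \<rightarrow>\<^sub>M ctrl_space S t"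
  unfolding ctrl_space_def
proof (intro measurable_Pair measurable_restrict)
  fix i assume "i \<in> {..t}"
  then show "symb S E K i \<in> past t \<rightarrow>\<^sub>M count_space (alphabet S)"
    using closed_loop_measurable_past[OF E K, of i] t by (intro measurable_past_mono[where s=i and t=t]) auto
next
  fix i assume "i \<in> {..<t}"
  then show "control S E K i \<in> past t \<rightarrow>\<^sub>M borel"
    using closed_loop_measurable_past[OF E K, of i] t by (intro measurable_past_mono[where s=i and t=t]) auto
qed

lemma
  assumes E: "admissible_encoder S E" and K: "admissible_controller S K" and t: "t \<le> hor S"
  shows ctrl_data_subset_past: "sets (ctrl_data S E K t) \<subseteq> sets (past t)"
    and subalgebra_ctrl_data: "subalgebra (Pr S) (ctrl_data S E K t)"
    and fun_hist_measurable_ctrl_data: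
      "(\<lambda>\<omega>. g (hist (symb S E K) (Suc t) \<omega>)) \<in> borel_measurable (ctrl_data S E K t)"
    and ctrl_data_atoms: "A \<in> sets (ctrl_data S E K t) \<Longrightarrow>
      \<exists>B. A = {\<omega> \<in> space (Pr S). hist (symb S E K) (Suc t) \<omega> \<in> B}"
proof -
  let ?D = "\<lambda>\<omega>. (\<lambda>i\<in>{..t}. symb S E K i \<omega>, \<lambda>i\<in>{..<t}. control S E K i \<omega>)"
  note D = ctrl_data_map_measurable[OF assms]
  have D_space: "?D \<in> space (Pr S) \<rightarrow> space (ctrl_space S t)"
    using measurable_space[OF D] by auto
  have sets_eq: "sets (ctrl_data S E K t) = {?D -` A \<inter> space (Pr S) | A. A \<in> sets (ctrl_space S t)}"
    unfolding ctrl_data_def by (rule sets_vimage_algebra2[OF D_space])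
  then show sub: "sets (ctrl_data S E K t) \<subseteq> sets (past t)"
    using measurable_sets[OF D] by auto
  have "sets (past t) \<subseteq> sets (Pr S)"
    using subalgebra_past[of t] t by (simp add: subalgebra_def)
  with sub show "subalgebra (Pr S) (ctrl_data S E K t)"
    by (auto simp: subalgebra_def ctrl_data_def)
  have "?D \<in> ctrl_data S E K t \<rightarrow>\<^sub>M ctrl_space S t"
    unfolding ctrl_data_def by (rule measurable_vimage_algebra1[OF D_space])
  then have "?D \<in> ctrl_data S E K t \<rightarrow>\<^sub>M count_space ({..t} \<rightarrow>\<^sub>E alphabet S) \<Otimes>\<^sub>M (\<Pi>\<^sub>M i\<in>{..<t}. borel)"
    unfolding ctrl_space_def PiM_alphabet[OF finite_atMost] .
  from measurable_compose[OF this measurable_fst]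
  have "(\<lambda>\<omega>. \<lambda>i\<in>{..t}. symb S E K i \<omega>) \<in> ctrl_data S E K t \<rightarrow>\<^sub>M count_space ({..t} \<rightarrow>\<^sub>E alphabet S)"
    by simp
  from measurable_compose[OF this, of g borel]
  show "(\<lambda>\<omega>. g (hist (symb S E K) (Suc t) \<omega>)) \<in> borel_measurable (ctrl_data S E K t)"
    by (simp add: hist_def lessThan_Suc_atMost)
  assume "A \<in> sets (ctrl_data S E K t)"
  then obtain A' where "A = ?D -` A' \<inter> space (Pr S)"
    unfolding sets_eq by blast
  then have "A = {\<omega> \<in> space (Pr S). hist (symb S E K) (Suc t) \<omega> \<in> {z. (z, \<lambda>i\<in>{..<t}. ctrl_seq K z i) \<in> A'}}"
    unfolding ctrl_data_map by auto
  then show "\<exists>B. A = {\<omega> \<in> space (Pr S). hist (symb S E K) (Suc t) \<omega> \<in> B}"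
    by blast
qed

text \<open>
  The characterization of conditional expectations by orthogonality, for candidates that are functions
  of the symbols received.
\<close>

lemma cond_exp_ctrl_data:
  assumes E: "admissible_encoder S E" and K: "admissible_controller S K" and t: "t \<le> hor S"
    and f: "integrable (Pr S) f"
    and orth: "\<And>A. A \<in> sets (ctrl_data S E K t) \<Longrightarrow>
      (\<integral>\<omega>. indicator A \<omega> * (f \<omega> - g (hist (symb S E K) (Suc t) \<omega>)) \<partial>Pr S) = 0"
  shows "AE \<omega> in Pr S. real_cond_exp (Pr S) (ctrl_data S E K t) f \<omega> = g (hist (symb S E K) (Suc t) \<omega>)"
proof -
  let ?h = "hist (symb S E K) (Suc t)"
  interpret finite_measure_subalgebra "Pr S" "ctrl_data S E K t"
    by unfold_locales (rule subalgebra_ctrl_data[OF E K t])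
  have g: "integrable (Pr S) (\<lambda>\<omega>. g (?h \<omega>))"
    using t by (intro fun_hist_integrable symb_causal E K) simp
  show ?thesis
  proof (rule real_cond_exp_charact[OF _ f g fun_hist_measurable_ctrl_data[OF E K t]])
    fix A assume A: "A \<in> sets (ctrl_data S E K t)"
    then have AM: "A \<in> sets (Pr S)"
      using subalgebra_ctrl_data[OF E K t] by (auto simp: subalgebra_def)
    have i: "integrable (Pr S) (\<lambda>\<omega>. indicator A \<omega> * f \<omega>)" "integrable (Pr S) (\<lambda>\<omega>. indicator A \<omega> * g (?h \<omega>))"
      using integrable_mult_indicator[OF AM f] integrable_mult_indicator[OF AM g] by simp_all
    have "(\<integral>\<omega>. indicator A \<omega> * f \<omega> \<partial>Pr S) - (\<integral>\<omega>. indicator A \<omega> * g (?h \<omega>) \<partial>Pr S) = 0"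
      using orth[OF A] by (subst Bochner_Integration.integral_diff[OF i, symmetric]) (simp add: right_diff_distrib)
    then show "set_lebesgue_integral (Pr S) A f = set_lebesgue_integral (Pr S) A (\<lambda>\<omega>. g (?h \<omega>))"
      by (simp add: set_lebesgue_integral_def)
  qed
qed

text \<open>
  Events in the controller's data are finite unions of events that fix the history of symbols, and on
  each of these the estimate is the mean of \<open>\<zeta>\<^sub>t\<close>.
\<close>

lemma state_error_orthogonal:
  assumes eps: "arg_inf_rule S eps" and K: "admissible_controller S K" and t: "t \<le> hor S"
    and A: "A \<in> sets (ctrl_data S (zeta_encoder S eps) K t)"
  shows "(\<integral>\<omega>. indicator A \<omega> * (zeta S t \<omega>
      - symbol_estimate eps t (hist (symb S (zeta_encoder S eps) K) (Suc t) \<omega>)) \<partial>Pr S) = 0"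
proof -
  let ?Z = "symb S (zeta_encoder S eps) K"
  let ?h = "hist ?Z (Suc t)" and ?est = "symbol_estimate eps t"
  let ?E = "\<lambda>z. {\<omega> \<in> space (Pr S). ?h \<omega> = z}"
  note E = admissible_zeta_encoder[OF eps]
  have Z: "realized_symbols eps ?Z" and cZ: "causal ?Z"
    by (rule realized_symbols_zeta_encoder[OF eps K], rule symb_causal[OF E K])
  obtain B where B: "A = {\<omega> \<in> space (Pr S). ?h \<omega> \<in> B}"
    using ctrl_data_atoms[OF E K t A] by blast
  have ev: "hist_event S (Suc t) z (realized_quantizers eps z (Suc t)) = ?E z"
    and qb: "quantizers_before (Suc t) (realized_quantizers eps z (Suc t))"
    if z: "z \<in> histories (Suc t)" for z
    using hist_event_realized[OF Z z] realized_quantizers_in_quantizers[OF eps _ z] t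
    by (auto simp: quantizers_before_def)
  have zero: "(\<integral>\<omega>. indicator (?E z) \<omega> * (zeta S t \<omega> - ?est z) \<partial>Pr S) = 0" if z: "z \<in> histories (Suc t)" for z
    using zeta_hat_centered[OF t qb[OF z], of z] unfolding ev[OF z] symbol_estimate_def .
  have int: "integrable (Pr S) (\<lambda>\<omega>. indicator (?E z) \<omega> * (zeta S t \<omega> - ?est z))" if z: "z \<in> histories (Suc t)" for z
  proof -
    have "?E z \<in> sets (Pr S)"
      unfolding ev[OF z, symmetric] by (rule hist_event_sets[OF qb[OF z]]) (use t in simp)
    from integrable_mult_indicator[OF this Bochner_Integration.integrable_diff[OF zeta_integrable[of t] integrable_const[of "?est z"]]] t
    show ?thesis by simp
  qed
  have "(\<integral>\<omega>. indicator A \<omega> * (zeta S t \<omega> - ?est (?h \<omega>)) \<partial>Pr S)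
    = (\<integral>\<omega>. (\<Sum>z\<in>histories (Suc t). indicator B z * (indicator (?E z) \<omega> * (zeta S t \<omega> - ?est z))) \<partial>Pr S)"
  proof (rule Bochner_Integration.integral_cong)
    fix \<omega> assume \<omega>: "\<omega> \<in> space (Pr S)"
    have "(\<Sum>z\<in>histories (Suc t). indicator B z * (indicator (?E z) \<omega> * (zeta S t \<omega> - ?est z)))
        = (\<Sum>z\<in>histories (Suc t). if ?h \<omega> = z then indicator B z * (zeta S t \<omega> - ?est z) else 0)"
      by (rule sum.cong) (use \<omega> in \<open>auto simp: indicator_def\<close>)
    also have "\<dots> = indicator B (?h \<omega>) * (zeta S t \<omega> - ?est (?h \<omega>))"
      using hist_in_histories[OF cZ _ \<omega>, of "Suc t"] t by (subst sum.delta') simp_all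
    also have "\<dots> = indicator A \<omega> * (zeta S t \<omega> - ?est (?h \<omega>))"
      using \<omega> by (auto simp: B indicator_def)
    finally show "indicator A \<omega> * (zeta S t \<omega> - ?est (?h \<omega>)) =
        (\<Sum>z\<in>histories (Suc t). indicator B z * (indicator (?E z) \<omega> * (zeta S t \<omega> - ?est z)))" ..
  qed simp
  also have "\<dots> = (\<Sum>z\<in>histories (Suc t). indicator B z * (\<integral>\<omega>. indicator (?E z) \<omega> * (zeta S t \<omega> - ?est z) \<partial>Pr S))"
    by (subst Bochner_Integration.integral_sum) (auto intro!: integrable_mult_right int)
  also have "\<dots> = 0"
    using zero by simp
  finally show ?thesis .
qed

definition state_estimate :: "quantizer_rule \<Rightarrow> controller \<Rightarrow> nat \<Rightarrow> (nat \<Rightarrow> nat) \<Rightarrow> real" where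
  "state_estimate eps K t z = symbol_estimate eps t z + drift S K z t"

lemma x_hat_zeta_encoder:
  assumes eps: "arg_inf_rule S eps" and K: "admissible_controller S K" and t: "t \<le> hor S"
  shows "AE \<omega> in Pr S. x_hat S (zeta_encoder S eps) K t \<omega>
    = state_estimate eps K t (hist (symb S (zeta_encoder S eps) K) (Suc t) \<omega>)"
  unfolding x_hat_def
proof (rule cond_exp_ctrl_data[OF admissible_zeta_encoder[OF eps] K t])
  show "integrable (Pr S) (state S (zeta_encoder S eps) K t)"
    unfolding state_eq_hist[abs_def]
    using t by (intro Bochner_Integration.integrable_add zeta_integrable fun_hist_integrable
      symb_causal admissible_zeta_encoder[OF eps] K) auto
next
  fix A assume "A \<in> sets (ctrl_data S (zeta_encoder S eps) K t)"
  from state_error_orthogonal[OF eps K t this]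
  show "(\<integral>\<omega>. indicator A \<omega> * (state S (zeta_encoder S eps) K t \<omega>
      - state_estimate eps K t (hist (symb S (zeta_encoder S eps) K) (Suc t) \<omega>)) \<partial>Pr S) = 0"
    by (simp add: state_eq_hist state_estimate_def)
qed

section \<open>Optimality and certainty equivalence\<close>

text \<open>
  The linear law written as a function of symbols and past controls: the estimate of \<open>\<zeta>\<^sub>t\<close> is corrected by
  the known effect of the controls.
\<close>

definition estimate_controller :: "quantizer_rule \<Rightarrow> controller" where
  "estimate_controller eps t z u =
     - kstar S t * (symbol_estimate eps t z + (\<Sum>j<t. gain S ^ (t - Suc j) * u j))"

lemma admissible_estimate_controller: "admissible_controller S (estimate_controller eps)"
  unfolding admissible_controller_def
proof (intro allI impI)
  fix t assume "t \<le> hor S"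
  have "(\<lambda>p. symbol_estimate eps t (fst p)) \<in> borel_measurable
      (count_space ({..t} \<rightarrow>\<^sub>E alphabet S) \<Otimes>\<^sub>M (\<Pi>\<^sub>M i\<in>{..<t}. borel :: real measure))"
    by (rule measurable_compose[OF measurable_fst]) simp
  moreover have "(\<lambda>p. snd p j) \<in> borel_measurable
      (count_space ({..t} \<rightarrow>\<^sub>E alphabet S) \<Otimes>\<^sub>M (\<Pi>\<^sub>M i\<in>{..<t}. borel :: real measure))" if "j < t" for j
    using that by (intro measurable_compose[OF measurable_snd measurable_component_singleton]) auto
  ultimately show "(\<lambda>(z, u). estimate_controller eps t z u) \<in> ctrl_space S t \<rightarrow>\<^sub>M borel"
    unfolding ctrl_space_def PiM_alphabet[OF finite_atMost] estimate_controller_def case_prod_beta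
    by (intro borel_measurable_times borel_measurable_add borel_measurable_sum borel_measurable_const) auto
qed

lemma linear_law_estimate_controller:
  assumes eps: "arg_inf_rule S eps"
  shows "linear_law S (zeta_encoder S eps) (estimate_controller eps)"
  unfolding linear_law_def
proof (intro allI impI)
  fix t assume t: "t \<le> hor S"
  let ?K = "estimate_controller eps"
  let ?Z = "symb S (zeta_encoder S eps) ?K"
  have ctrl: "control S (zeta_encoder S eps) ?K t \<omega> = - kstar S t * state_estimate eps ?K t (hist ?Z (Suc t) \<omega>)" for \<omega>
  proof -
    have "(\<lambda>i\<in>{..t}. ?Z i \<omega>) = hist ?Z (Suc t) \<omega>"
      by (simp add: hist_def lessThan_Suc_atMost)
    moreover have "control S (zeta_encoder S eps) ?K j \<omega> = ctrl_seq ?K (hist ?Z (Suc t) \<omega>) j" if "j < t" for j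
      unfolding control_eq_ctrl_seq by (rule ctrl_seq_cong) (use that in \<open>auto simp: hist_def\<close>)
    ultimately show ?thesis
      by (subst control.simps) (simp add: estimate_controller_def state_estimate_def drift_def)
  qed
  show "AE \<omega> in Pr S. control S (zeta_encoder S eps) ?K t \<omega> = - kstar S t * x_hat S (zeta_encoder S eps) ?K t \<omega>"
    using x_hat_zeta_encoder[OF eps admissible_estimate_controller[of eps] t] by eventually_elim (simp add: ctrl)
qed

lemma linear_law_control:
  assumes eps: "arg_inf_rule S eps" and K: "admissible_controller S K"
    and lin: "linear_law S (zeta_encoder S eps) K" and t: "t \<le> hor S"
  shows "AE \<omega> in Pr S. control S (zeta_encoder S eps) K t \<omega>
    = - kstar S t * state_estimate eps K t (hist (symb S (zeta_encoder S eps) K) (Suc t) \<omega>)"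
proof -
  have "AE \<omega> in Pr S. control S (zeta_encoder S eps) K t \<omega> = - kstar S t * x_hat S (zeta_encoder S eps) K t \<omega>"
    using lin t unfolding linear_law_def by blast
  with x_hat_zeta_encoder[OF eps K t] show ?thesis
    by eventually_elim simp
qed

lemma J_linear_law:
  assumes eps: "arg_inf_rule S eps" and K: "admissible_controller S K"
    and lin: "linear_law S (zeta_encoder S eps) K"
  shows "J S (zeta_encoder S eps) K = ennreal (noise_cost + Gam_star S 0 (\<lambda>_. undefined) (\<lambda>_. undefined))"
proof -
  let ?Z = "symb S (zeta_encoder S eps) K"
  note E = admissible_zeta_encoder[OF eps]
  have "(qwt S + beta S (Suc i)) * (\<integral>\<omega>. (control S (zeta_encoder S eps) K i \<omega>
      + kstar S i * state S (zeta_encoder S eps) K i \<omega>)\<^sup>2 \<partial>Pr S)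
    = lam S i * (\<integral>\<omega>. (zeta S i \<omega> - symbol_estimate eps i (hist ?Z (Suc i) \<omega>))\<^sup>2 \<partial>Pr S)" (is "_ * ?l = _ * ?r")
    if i: "i \<in> {0..hor S}" for i
  proof -
    from i have i': "i \<le> hor S"
      by simp
    have [measurable]: "control S (zeta_encoder S eps) K i \<in> borel_measurable (Pr S)"
      "state S (zeta_encoder S eps) K i \<in> borel_measurable (Pr S)"
      using closed_loop_measurable_past[OF E K i'] i' by (auto intro: measurable_past_imp[of _ i])
    have int: "integrable (Pr S) (\<lambda>\<omega>. (zeta S i \<omega> - symbol_estimate eps i (hist ?Z (Suc i) \<omega>))\<^sup>2)"
      by (intro error_sq_integrable symb_causal E K i')
    have "?l = (\<integral>\<omega>. (kstar S i)\<^sup>2 * (zeta S i \<omega> - symbol_estimate eps i (hist ?Z (Suc i) \<omega>))\<^sup>2 \<partial>Pr S)"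
    proof (rule integral_cong_AE)
      show "AE \<omega> in Pr S. (control S (zeta_encoder S eps) K i \<omega>
          + kstar S i * state S (zeta_encoder S eps) K i \<omega>)\<^sup>2
        = (kstar S i)\<^sup>2 * (zeta S i \<omega> - symbol_estimate eps i (hist ?Z (Suc i) \<omega>))\<^sup>2"
        using linear_law_control[OF eps K lin i']
        by eventually_elim (simp add: state_eq_hist state_estimate_def flip: power_mult_distrib, simp add: algebra_simps)
    qed (use int in auto)
    then show ?thesis
      by (simp add: lam_eq[OF weights])
  qed
  then show ?thesis
    unfolding J_decomposition[OF E K] Gam_star_eq_realized_error[OF eps realized_symbols_zeta_encoder[OF eps K]]
    by (intro arg_cong[where f=ennreal] arg_cong2[where f="(+)"] sum.cong refl)
qed

text \<open>
  The decoder in the bound reads off from \<open>u\<^sub>t\<close> the value of \<open>\<zeta>\<^sub>t\<close> for which the gap would vanish.  Where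
  \<open>k\<^sub>t = 0\<close> the error has weight \<open>\<lambda>\<^sub>t = 0\<close> and any decoder will do.
\<close>

lemma J_lower_bound:
  assumes E: "admissible_encoder S E" and K: "admissible_controller S K"
  shows "ennreal (noise_cost + Gam_star S 0 (\<lambda>_. undefined) e) \<le> J S E K"
proof -
  let ?Z = "symb S E K"
  have Z: "causal ?Z"
    by (rule symb_causal[OF E K])
  \<comment> \<open>If the gain is 0, division yields 0; the weight of the error then vanishes as well.\<close>
  define d where "d i z = - ctrl_seq K z i / kstar S i - drift S K z i" for i z
  have "lam S i * (\<integral>\<omega>. (zeta S i \<omega> - d i (hist ?Z (Suc i) \<omega>))\<^sup>2 \<partial>Pr S)
    \<le> (qwt S + beta S (Suc i)) * (\<integral>\<omega>. (control S E K i \<omega> + kstar S i * state S E K i \<omega>)\<^sup>2 \<partial>Pr S)" for i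
  proof (cases "kstar S i = 0")
    case True
    then show ?thesis
      using gap_weight_pos[of i] by (simp add: lam_eq[OF weights])
  next
    case False
    have "(control S E K i \<omega> + kstar S i * state S E K i \<omega>)\<^sup>2
        = (kstar S i)\<^sup>2 * (zeta S i \<omega> - d i (hist ?Z (Suc i) \<omega>))\<^sup>2" for \<omega>
      using False by (simp add: gap_eq_hist d_def algebra_simps flip: power_mult_distrib)
    then show ?thesis
      by (simp add: lam_eq[OF weights])
  qed
  then have "Gam_star S 0 (\<lambda>_. undefined) e \<le> (\<Sum>i=0..hor S. (qwt S + beta S (Suc i))
      * (\<integral>\<omega>. (control S E K i \<omega> + kstar S i * state S E K i \<omega>)\<^sup>2 \<partial>Pr S))"
    by (intro order_trans[OF Gam_star_le_causal_error[OF Z, where d=d]] sum_mono)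
  then show ?thesis
    unfolding J_decomposition[OF E K] by (intro ennreal_leI) simp
qed

text \<open>
  The control for known noise is \<open>- k\<^sub>t x\<^sub>t - r\<^sub>t\<close>.  Conditioning replaces \<open>x\<^sub>t\<close> by its estimate and
  removes \<open>r\<^sub>t\<close>, which is orthogonal to every event in the controller's data.
\<close>

lemma certainty_equivalence:
  assumes eps: "arg_inf_rule S eps" and K: "admissible_controller S K"
    and lin: "linear_law S (zeta_encoder S eps) K"
  shows "certainty_equivalence_law S (zeta_encoder S eps) K"
  unfolding certainty_equivalence_law_def Let_def
proof (intro allI impI)
  fix t assume t: "t \<le> hor S"
  let ?E = "zeta_encoder S eps"
  let ?h = "hist (symb S ?E K) (Suc t)"
  let ?ustar = "\<lambda>\<omega>. known_noise_control S t (\<lambda>i\<in>{..<t}. control S ?E K i \<omega>) \<omega>"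
  note E = admissible_zeta_encoder[OF eps]
  have ustar: "?ustar \<omega> = - kstar S t * zeta S t \<omega> - kstar S t * drift S K (?h \<omega>) t - preview S t \<omega>" for \<omega>
  proof -
    have "open_loop_state S (\<lambda>i\<in>{..<t}. control S ?E K i \<omega>) \<omega> t
        = open_loop_state S (\<lambda>i. control S ?E K i \<omega>) \<omega> t"
      by (rule open_loop_state_cong) simp
    then show ?thesis
      by (simp add: known_noise_control_eq[OF weights t] open_loop_state_control state_eq_hist distrib_left)
  qed
  have int: "integrable (Pr S) ?ustar"
    unfolding ustar
    using t by (intro Bochner_Integration.integrable_diff integrable_mult_right zeta_integrable
      fun_hist_integrable preview_integrable symb_causal E K) auto
  have "AE \<omega> in Pr S. real_cond_exp (Pr S) (ctrl_data S ?E K t) ?ustar \<omega> = - kstar S t * state_estimate eps K t (?h \<omega>)"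
  proof (rule cond_exp_ctrl_data[OF E K t int])
    fix A assume A: "A \<in> sets (ctrl_data S ?E K t)"
    then have Ap: "A \<in> sets (past t)"
      using ctrl_data_subset_past[OF E K t] by auto
    then have AM: "A \<in> sets (Pr S)"
      using subalgebra_past[of t] t by (auto simp: subalgebra_def)
    have "integrable (Pr S) (indicator A :: 'w \<Rightarrow> real)"
      using AM by (simp add: emeasure_eq_measure)
    from past_preview_uncorrelated[OF _ this order_refl] Ap
    have R: "integrable (Pr S) (\<lambda>\<omega>. indicator A \<omega> * preview S t \<omega>)"
      "(\<integral>\<omega>. indicator A \<omega> * preview S t \<omega> \<partial>Pr S) = 0"
      by auto
    have "integrable (Pr S) (\<lambda>\<omega>. zeta S t \<omega> - symbol_estimate eps t (?h \<omega>))"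
      using t by (intro Bochner_Integration.integrable_diff zeta_integrable fun_hist_integrable symb_causal E K) auto
    from integrable_mult_indicator[OF AM this]
    have err: "integrable (Pr S) (\<lambda>\<omega>. indicator A \<omega> * (zeta S t \<omega> - symbol_estimate eps t (?h \<omega>)))"
      by simp
    have "(\<integral>\<omega>. indicator A \<omega> * (?ustar \<omega> - - kstar S t * state_estimate eps K t (?h \<omega>)) \<partial>Pr S) =
      (\<integral>\<omega>. - kstar S t * (indicator A \<omega> * (zeta S t \<omega> - symbol_estimate eps t (?h \<omega>)))
        - indicator A \<omega> * preview S t \<omega> \<partial>Pr S)"
      by (rule Bochner_Integration.integral_cong) (simp_all add: ustar state_estimate_def algebra_simps)
    also have "\<dots> = 0"
      by (subst Bochner_Integration.integral_diff[OF integrable_mult_right[OF err] R(1)])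
         (simp only: integral_mult_right_zero state_error_orthogonal[OF eps K t A] R(2) mult_zero_right diff_zero)
    finally show "(\<integral>\<omega>. indicator A \<omega> * (?ustar \<omega> - - kstar S t * state_estimate eps K t (?h \<omega>)) \<partial>Pr S) = 0" .
  qed
  then have "AE \<omega> in Pr S. control S ?E K t \<omega> = real_cond_exp (Pr S) (ctrl_data S ?E K t) ?ustar \<omega>"
    using linear_law_control[OF eps K lin t] by eventually_elim simp
  with int show "integrable (Pr S) ?ustar \<and>
      (AE \<omega> in Pr S. control S ?E K t \<omega> = real_cond_exp (Pr S) (ctrl_data S ?E K t) ?ustar \<omega>)"
    by blast
qed

end

theorem theorem1:
  fixes S :: "'w lqg" and x0bar \<sigma>0 \<sigma>w :: real and eps :: quantizer_rule
  assumes prob: "prob_space (Pr S)"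
    and indep: "prob_space.indep_vars (Pr S) (\<lambda>_. borel)
                  (case_nat (init S) (noise S)) {..Suc (hor S)}"
    and init_sq: "integrable (Pr S) (\<lambda>\<omega>. (init S \<omega>)\<^sup>2)"
    and init_mean: "prob_space.expectation (Pr S) (init S) = x0bar"
    and init_var: "prob_space.variance (Pr S) (init S) = \<sigma>0\<^sup>2"
    and noise_sq: "\<And>t. t \<le> hor S \<Longrightarrow> integrable (Pr S) (\<lambda>\<omega>. (noise S t \<omega>)\<^sup>2)"
    and noise_mean: "\<And>t. t \<le> hor S \<Longrightarrow> prob_space.expectation (Pr S) (noise S t) = 0"
    and noise_var: "\<And>t. t \<le> hor S \<Longrightarrow> prob_space.variance (Pr S) (noise S t) = \<sigma>w\<^sup>2"
    and weights: "0 < pwt S" "0 < qwt S"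
    and nonempty_alphabet: "1 \<le> nsym S"
    and arg_inf: "arg_inf_rule S eps"
  shows "admissible_encoder S (zeta_encoder S eps) \<and>
    controls_forgetting S 0 (zeta_encoder S eps) \<and>
    (\<exists>K. admissible_controller S K \<and> linear_law S (zeta_encoder S eps) K) \<and>
    (\<forall>K. admissible_controller S K \<and> linear_law S (zeta_encoder S eps) K \<longrightarrow>
       optimal_pair S (zeta_encoder S eps) K \<and>
       certainty_equivalence_law S (zeta_encoder S eps) K)"
proof -
  interpret prob_space "Pr S"
    by (rule prob)
  interpret lqg_system S
    by unfold_locales (use indep init_sq noise_sq noise_mean weights nonempty_alphabet in auto)
  note E = admissible_zeta_encoder[OF arg_inf]
  have "optimal_pair S (zeta_encoder S eps) K"
    if "admissible_controller S K" "linear_law S (zeta_encoder S eps) K" for K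
    using that E J_lower_bound by (auto simp: optimal_pair_def J_linear_law[OF arg_inf])
  then show ?thesis
    using E controls_forgetting_zeta_encoder[OF arg_inf] admissible_estimate_controller
      linear_law_estimate_controller[OF arg_inf] certainty_equivalence[OF arg_inf] by blast
qed

end
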